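(* Let $N\ge1$, $0<p<1$, and assume $\beta_-=\frac12-\sqrt{\frac14-\mu}<0$ (that is, $\mu<0$). Let $v(0)$ be an arbitrary positive constant. Then there exists near $r=R$, respectively near $r=r_0$, a one-parameter family of local solutions of $$u''+\frac{N-1}{r}u'+\frac{\mu}{\delta^2}u=u^p$$ of the form $$u(r)=\delta^{\beta_-}v(0)\Big(1+\frac{N-1}{2R}\delta+\eta(\delta,C)\Big)+C\delta^{\beta_+}\qquad(\delta=R-r),$$ respectively $$u(r)=\delta^{\beta_-}v(0)\Big(1-\frac{N-1}{2r_0}\delta+\eta(\delta,C)\Big)+C\delta^{\beta_+}\qquad(\delta=r-r_0),$$ where, as $\delta\to0$, $$\eta(\delta,C)=\begin{cases}o(\delta^{1-2\beta_-})&\text{if }-\frac12<\beta_-<0,\\ K\delta^2|\log\delta|+o(\delta^2|\log\delta|)&\text{if }\beta_-=-\frac12,\\ K\delta^2+o(\delta^2)&\text{if }\beta_-<-\frac12,\end{cases}$$ and $K$ is a constant which depends on the data of the problem but neither on $v(0)$ nor on the parameter $C>0$, while the higher order terms do depend on both $v(0)$ and $C>0$. (If $\beta_-\le-\frac12$ the term $C\delta^{\beta_+}$ would be included in the higher order term, but it is written explicitly since $C$ is the parameter on which the solutions depend.)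
   Context: $\beta_+=\frac12+\sqrt{\frac14-\mu}$. The equation is that of radial solutions of $\Delta u+\frac{\mu}{\delta^2}u=u^p$ in the annulus $\{x\in\mathbb{R}^N:r_0<|x|<R\}$, $0<r_0<R$ (the case of a ball $B_R$ coincides with that of the outer boundary), where $\delta$ denotes the distance to the boundary. A local solution near $r=R$ (resp. $r=r_0$) is one defined for $0<\delta<\delta_0$ for some $\delta_0>0$. The data of the problem are $N,p,\mu,R,r_0$. *)

theory Defs
  imports "HOL-Analysis.Analysis" "HOL-Library.Landau_Symbols"
begin

definition beta_minus :: "real \<Rightarrow> real" where
  "beta_minus \<mu> = 1/2 - sqrt (1/4 - \<mu>)"

definition beta_plus :: "real \<Rightarrow> real" where
  "beta_plus \<mu> = 1/2 + sqrt (1/4 - \<mu>)"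

text \<open>For a point \<open>x\<close> of the annulus \<open>r0 < |x| < R\<close> with \<open>|x| = r\<close>, the distance
  from \<open>x\<close> to the boundary is the distance from \<open>r\<close> to the two-point set \<open>{r0, R}\<close>.\<close>

definition bdist :: "real \<Rightarrow> real \<Rightarrow> real \<Rightarrow> real" where
  "bdist r0 R r = infdist r {r0, R}"

lemma bdist_eq_min: "r0 < r \<Longrightarrow> r < R \<Longrightarrow> bdist r0 R r = min (r - r0) (R - r)"
  unfolding bdist_def infdist_def
  by (simp add: dist_real_def cInf_eq_Min)

text \<open>Nonnegative classical solutions on an open set \<open>S\<close>. Nonnegativity makes \<open>u\<^sup>p\<close>
  meaningful for \<open>0 < p < 1\<close>; continuity of the second derivative follows from the equation.\<close>

definition radial_solution_on ::
  "nat \<Rightarrow> real \<Rightarrow> real \<Rightarrow> real \<Rightarrow> real \<Rightarrow> real set \<Rightarrow> (real \<Rightarrow> real) \<Rightarrow> bool" where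
  "radial_solution_on N p \<mu> r0 R S u \<longleftrightarrow>
     (\<forall>r\<in>S. 0 \<le> u r \<and>
        u differentiable (at r) \<and> deriv u differentiable (at r) \<and>
        deriv (deriv u) r + (real N - 1) / r * deriv u r + \<mu> / (bdist r0 R r)\<^sup>2 * u r = u r powr p)"

definition eta_asymptotics :: "real \<Rightarrow> real \<Rightarrow> (real \<Rightarrow> real) \<Rightarrow> bool" where
  "eta_asymptotics \<beta> K h \<longleftrightarrow>
     (-1/2 < \<beta> \<longrightarrow> h \<in> o[at_right 0](\<lambda>\<delta>. \<delta> powr (1 - 2 * \<beta>))) \<and>
     (\<beta> = -1/2 \<longrightarrow>
        (\<lambda>\<delta>. h \<delta> - K * (\<delta>\<^sup>2 * \<bar>ln \<delta>\<bar>)) \<in> o[at_right 0](\<lambda>\<delta>. \<delta>\<^sup>2 * \<bar>ln \<delta>\<bar>)) \<and>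
     (\<beta> < -1/2 \<longrightarrow> (\<lambda>\<delta>. h \<delta> - K * \<delta>\<^sup>2) \<in> o[at_right 0](\<lambda>\<delta>. \<delta>\<^sup>2))"

text \<open>The map \<open>x\<close> parametrizes a neighbourhood of one of the two boundary points by
  \<open>\<delta>\<close>: \<open>x \<delta> = R - \<delta>\<close> near \<open>R\<close> and \<open>x \<delta> = r0 + \<delta>\<close> near \<open>r0\<close>; the bound
  \<open>\<delta>0 \<le> (R - r0) / 2\<close> ensures that \<open>x \<delta>\<close> lies in the annulus and that \<open>\<delta>\<close> is
  its distance to the boundary. Here \<open>a\<close> is the coefficient of \<open>\<delta>\<close> in the
  expansion, \<open>v\<close> stands for \<open>v(0)\<close>, and \<open>u v C\<close> is the solution for the parameter \<open>C\<close>.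
  Since \<open>K\<close> is fixed before \<open>v\<close> and \<open>C\<close>, it is independent of both.
  The second conjunct says that the solutions really form a one-parameter family: distinct
  parameters give distinct germs at the boundary. (For \<open>\<beta>\<^sub>- \<le> -1/2\<close> this does
  not follow from the expansion.) The last two say that \<open>\<eta>\<close>, equivalently its part beyond
  the \<open>K\<close>-term, depends on \<open>C\<close> and on \<open>v\<close>.\<close>

definition local_solution_family ::
  "nat \<Rightarrow> real \<Rightarrow> real \<Rightarrow> real \<Rightarrow> real \<Rightarrow> (real \<Rightarrow> real) \<Rightarrow> real \<Rightarrow> real \<Rightarrow>
   (real \<Rightarrow> real \<Rightarrow> real \<Rightarrow> real) \<Rightarrow> (real \<Rightarrow> real \<Rightarrow> real \<Rightarrow> real) \<Rightarrow> bool" where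
  "local_solution_family N p \<mu> r0 R x a K u \<eta> \<longleftrightarrow>
     (\<forall>v>0. \<forall>C>0.
        (\<exists>\<delta>0>0. \<delta>0 \<le> (R - r0) / 2 \<and>
           radial_solution_on N p \<mu> r0 R (x ` {0<..<\<delta>0}) (u v C) \<and>
           (\<forall>\<delta>\<in>{0<..<\<delta>0}.
              u v C (x \<delta>) = \<delta> powr (beta_minus \<mu>) * v * (1 + a * \<delta> + \<eta> v C \<delta>)
                            + C * \<delta> powr (beta_plus \<mu>))) \<and>
        eta_asymptotics (beta_minus \<mu>) K (\<eta> v C)) \<and>
     (\<forall>v>0. \<forall>C>0. \<forall>C'>0. C \<noteq> C' \<longrightarrow>
        \<not> (\<forall>\<^sub>F \<delta> in at_right 0. u v C (x \<delta>) = u v C' (x \<delta>))) \<and>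
     (\<forall>v>0. \<exists>C>0. \<exists>C'>0. \<not> (\<forall>\<^sub>F \<delta> in at_right 0. \<eta> v C \<delta> = \<eta> v C' \<delta>)) \<and>
     (\<forall>C>0. \<exists>v>0. \<exists>v'>0. \<not> (\<forall>\<^sub>F \<delta> in at_right 0. \<eta> v C \<delta> = \<eta> v' C \<delta>))"

end

theory Submission
  imports Defs "HOL-Real_Asymp.Real_Asymp"
begin

text \<open>Write \<open>\<rho>\<close> for the boundary radius, \<open>r = \<rho> + \<sigma> \<delta>\<close> with \<open>\<sigma> = \<plusminus>1\<close>, \<open>\<tau> = \<sigma> / \<rho>\<close> and
  \<open>M(\<delta>) = (1 + \<tau> \<delta>)\<^sup>e\<close> with \<open>e = -(N - 1) / 2\<close>. The Liouville substitution \<open>w = M \<delta>\<^sup>\<beta> z\<close> turns the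
  equation into \<open>(\<delta>\<^bsup>2\<beta>\<^esup> z')' = \<delta>\<^bsup>2\<beta>\<^esup> G(\<delta>, z)\<close> with \<open>G\<close> continuous up to \<open>\<delta> = 0\<close>, because
  \<open>(p - 1) \<beta> > 0\<close>. Integrating twice with \<open>z(0) = v\<close> and the free constant \<open>c = (1 - 2\<beta>) C\<close> gives a
  contraction on a short interval. The expansion of \<open>z\<close> follows from l'Hospital's rule applied to
  \<open>z' = \<delta>\<^bsup>-2\<beta>\<^esup> B\<close>, \<open>B' = \<delta>\<^bsup>2\<beta>\<^esup> G\<close>, and that of \<open>M\<close> contributes the linear term and part of \<open>K\<close>.
  If two remainders \<open>\<eta>\<close> had the same germ, a linear combination of two solutions would be a multiple
  of \<open>\<delta>\<^bsup>1-\<beta>\<^esup>\<close>; inserting it into the equation equates a combination of \<open>p\<close>-th powers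
  with a multiple of \<open>\<delta>\<^bsup>-\<beta>\<^esup>\<close>, which the growth of the solutions rules out.\<close>

section \<open>Weighted primitives and the fixed point\<close>

text \<open>The base point is \<open>0\<close> when \<open>t powr (2 * \<beta>)\<close> is integrable there, so that the primitive
  vanishes at \<open>0\<close> and the coefficient of \<open>\<delta> powr (1 - \<beta>)\<close> in the solution is exactly the
  prescribed one; otherwise it has to be moved to \<open>d\<close>.\<close>

definition weighted_primitive :: "real \<Rightarrow> real \<Rightarrow> (real \<Rightarrow> real) \<Rightarrow> real \<Rightarrow> real" where
  "weighted_primitive \<beta> d g s =
     (if -1/2 < \<beta> then integral {0..s} (\<lambda>t. t powr (2*\<beta>) * g t)
      else - integral {s..d} (\<lambda>t. t powr (2*\<beta>) * g t))"

lemma weighted_primitive_zero: "weighted_primitive \<beta> d (\<lambda>_. 0) s = 0"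
  by (simp add: weighted_primitive_def)

text \<open>The power is absolutely integrable because its exponent exceeds -1, and a bounded
  measurable factor preserves this.\<close>

lemma integrable_on_powr_mult_continuous:
  fixes g :: "real \<Rightarrow> real"
  assumes "-1 < a" "0 \<le> d" "continuous_on {0..d} g"
  shows "(\<lambda>t. t powr a * g t) integrable_on {0..d}"
proof -
  have "(\<lambda>t. t powr a) absolutely_integrable_on {0..d}"
    by (intro nonnegative_absolutely_integrable_1 integrable_on_powr_from_0 assms) auto
  moreover have "g \<in> borel_measurable (lebesgue_on {0..d})"
    by (intro continuous_imp_measurable_on_sets_lebesgue assms) auto
  moreover have "bounded (g ` {0..d})"
    by (intro compact_imp_bounded compact_continuous_image assms) auto
  ultimately have "(\<lambda>t. g t * t powr a) absolutely_integrable_on {0..d}"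
    by (intro absolutely_integrable_bounded_measurable_product_real) auto
  then show ?thesis
    by (simp add: absolutely_integrable_on_def mult.commute)
qed

lemma continuous_on_powr_mult:
  fixes g :: "real \<Rightarrow> real"
  assumes "0 < a" "continuous_on {0..d} g"
  shows "continuous_on {a..d} (\<lambda>t. t powr b * g t)"
  using assms by (intro continuous_intros continuous_on_subset[OF assms(2)]) auto

text \<open>Both choices of base point give an ordinary integral once one starts from some
  \<open>a > 0\<close>. This keeps the singularity at 0 out of the differentiation that
  follows.\<close>

lemma weighted_primitive_diff:
  assumes "continuous_on {0..d} g" "0 < a" "a \<le> s" "s \<le> d"
  shows "weighted_primitive \<beta> d g s =
    weighted_primitive \<beta> d g a + integral {a..s} (\<lambda>t. t powr (2*\<beta>) * g t)"
proof (cases "-1/2 < \<beta>")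
  case True
  have "(\<lambda>t. t powr (2*\<beta>) * g t) integrable_on {0..s}"
    using assms True
    by (intro integrable_on_powr_mult_continuous continuous_on_subset[OF assms(1)]) auto
  with assms True show ?thesis
    by (simp add: weighted_primitive_def Henstock_Kurzweil_Integration.integral_combine)
next
  case False
  have "(\<lambda>t. t powr (2*\<beta>) * g t) integrable_on {a..d}"
    by (intro integrable_continuous_real continuous_on_powr_mult assms)
  then have "integral {a..s} (\<lambda>t. t powr (2*\<beta>) * g t) + integral {s..d} (\<lambda>t. t powr (2*\<beta>) * g t)
      = integral {a..d} (\<lambda>t. t powr (2*\<beta>) * g t)"
    using assms by (intro Henstock_Kurzweil_Integration.integral_combine) auto
  with False show ?thesis
    by (simp add: weighted_primitive_def)
qed

lemma weighted_primitive_has_derivative_within: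
  assumes "continuous_on {0..d} g" "0 < s" "s \<le> d"
  shows "(weighted_primitive \<beta> d g has_real_derivative s powr (2*\<beta>) * g s) (at s within {0..d})"
proof -
  have c: "continuous_on {s/2..d} (\<lambda>t. t powr (2*\<beta>) * g t)"
    by (intro continuous_on_powr_mult assms) (use assms in auto)
  have "((\<lambda>x. weighted_primitive \<beta> d g (s/2) + integral {s/2..x} (\<lambda>t. t powr (2*\<beta>) * g t))
      has_real_derivative 0 + s powr (2*\<beta>) * g s) (at s within {s/2..d})"
    by (intro DERIV_add DERIV_const integral_has_real_derivative c) (use assms in auto)
  then have "(weighted_primitive \<beta> d g has_real_derivative 0 + s powr (2*\<beta>) * g s)
      (at s within {s/2..d})"
  proof (rule has_field_derivative_transform_within[where d=1])
    show "weighted_primitive \<beta> d g (s/2) + integral {s/2..x} (\<lambda>t. t powr (2*\<beta>) * g t)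
      = weighted_primitive \<beta> d g x" if "x \<in> {s/2..d}" for x
      using that assms by (intro weighted_primitive_diff[symmetric]) auto
  qed (use assms in auto)
  moreover have "at s within {s/2..d} = at s within {0..d}"
    by (rule at_within_nhd[where S="{s/2<..}"]) (use assms in auto)
  ultimately show ?thesis by simp
qed

text \<open>The first value comes from integrating \<open>t powr (2*\<beta>)\<close> exactly over
  \<open>{0..s}\<close>, the second from integrating \<open>1 / sqrt t\<close> over
  \<open>{s..d}\<close> with \<open>d \<le> 1\<close>.\<close>

definition primitive_bound :: "real \<Rightarrow> real" where
  "primitive_bound \<beta> = (if -1/2 < \<beta> then 1 / (2*\<beta> + 1) else 2)"

lemma primitive_bound_pos: "0 < primitive_bound \<beta>"
  by (simp add: primitive_bound_def)

text \<open>For an integrable weight the left side is at most a multiple of \<open>s\<close>, hence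
  of \<open>sqrt s\<close> as \<open>s \<le> 1\<close>. Otherwise \<open>s \<le> t\<close> and
  \<open>-2*\<beta> \<ge> 1\<close>, so the kernel \<open>(s/t) powr (-2*\<beta>)\<close> is at most
  \<open>sqrt (s/t)\<close>. The rate \<open>sqrt s\<close> serves both regimes, including the
  logarithmic case \<open>\<beta> = -1/2\<close>.\<close>

lemma weighted_primitive_bound:
  assumes cont: "continuous_on {0..d} g" "continuous_on {0..d} h"
    and s: "0 < s" "s \<le> d" "d \<le> 1"
    and E: "\<And>t. t \<in> {0..d} \<Longrightarrow> \<bar>g t - h t\<bar> \<le> E"
  shows "s powr (-2*\<beta>) * \<bar>weighted_primitive \<beta> d g s - weighted_primitive \<beta> d h s\<bar>
    \<le> primitive_bound \<beta> * E * sqrt s"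
proof -
  let ?f = "\<lambda>t. t powr (2*\<beta>) * (g t - h t)"
  have E0: "0 \<le> E" using E[of s] s by auto
  show ?thesis
  proof (cases "-1/2 < \<beta>")
    case True
    have ig: "(\<lambda>t. t powr (2*\<beta>) * k t) integrable_on {0..s}" if "continuous_on {0..d} k" for k
      using s True that
      by (intro integrable_on_powr_mult_continuous continuous_on_subset[OF that]) auto
    have "weighted_primitive \<beta> d g s - weighted_primitive \<beta> d h s = integral {0..s} ?f"
      using True
      by (simp add: weighted_primitive_def integral_diff[symmetric] ig cont right_diff_distrib)
    also have "\<bar>\<dots>\<bar> \<le> integral {0..s} (\<lambda>t. E * t powr (2*\<beta>))"
    proof (rule Henstock_Kurzweil_Integration.integral_norm_bound_integral[where 'a=real, unfolded real_norm_def])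
      show "?f integrable_on {0..s}"
        by (intro ig continuous_intros cont)
      show "(\<lambda>t. E * t powr (2*\<beta>)) integrable_on {0..s}"
        by (intro integrable_on_mult_right integrable_on_powr_from_0) (use True s in auto)
      show "\<bar>?f t\<bar> \<le> E * t powr (2*\<beta>)" if "t \<in> {0..s}" for t
        using mult_right_mono[OF E[of t], of "t powr (2*\<beta>)"] that s by (simp add: abs_mult mult.commute)
    qed
    also have "\<dots> = E * (s powr (2*\<beta>+1) / (2*\<beta>+1))"
      using integral_unique[OF has_integral_powr_from_0[of "2*\<beta>" s]] True s by simp
    finally have "s powr (-2*\<beta>) * \<bar>weighted_primitive \<beta> d g s - weighted_primitive \<beta> d h s\<bar>
        \<le> s powr (-2*\<beta>) * (E * (s powr (2*\<beta>+1) / (2*\<beta>+1)))"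
      by (intro mult_left_mono) auto
    also have "\<dots> = E / (2*\<beta>+1) * (s powr (-2*\<beta>) * s powr (2*\<beta>+1))"
      by simp
    also have "s powr (-2*\<beta>) * s powr (2*\<beta>+1) = s"
      using s by (simp add: powr_add[symmetric])
    also have "E / (2*\<beta>+1) * s \<le> E / (2*\<beta>+1) * sqrt s"
      using E0 s True by (intro mult_left_mono real_le_rsqrt) (auto simp: power2_eq_square mult_left_le)
    finally show ?thesis using True by (simp add: primitive_bound_def)
  next
    case False
    have ig: "(\<lambda>t. t powr (2*\<beta>) * k t) integrable_on {s..d}" if "continuous_on {0..d} k" for k
      by (intro integrable_continuous_real continuous_on_powr_mult that s)
    have "integral {s..d} ?f =
        integral {s..d} (\<lambda>t. t powr (2*\<beta>) * g t) - integral {s..d} (\<lambda>t. t powr (2*\<beta>) * h t)"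
      unfolding right_diff_distrib by (intro Henstock_Kurzweil_Integration.integral_diff ig cont)
    then have 1: "weighted_primitive \<beta> d g s - weighted_primitive \<beta> d h s = - integral {s..d} ?f"
      using False by (simp add: weighted_primitive_def)
    have "((\<lambda>t. 2 * sqrt t) has_real_derivative 1 / sqrt t) (at t within {s..d})"
      if "t \<in> {s..d}" for t
    proof -
      have "((\<lambda>t. 2 * sqrt t) has_real_derivative 2 * (inverse (sqrt t) / 2)) (at t within {s..d})"
        by (intro DERIV_cmult has_field_derivative_at_within[OF DERIV_real_sqrt]) (use that s in auto)
      then show ?thesis by (simp add: inverse_eq_divide)
    qed
    then have "((\<lambda>t. 1 / sqrt t) has_integral (2 * sqrt d - 2 * sqrt s)) {s..d}"
      using s by (intro fundamental_theorem_of_calculus)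
        (auto simp: has_real_derivative_iff_has_vector_derivative)
    then have sq: "((\<lambda>t. E * sqrt s * (1 / sqrt t)) has_integral
        E * sqrt s * (2 * sqrt d - 2 * sqrt s)) {s..d}"
      by (rule has_integral_mult_right)
    have "s powr (-2*\<beta>) * \<bar>integral {s..d} ?f\<bar> = \<bar>integral {s..d} (\<lambda>t. s powr (-2*\<beta>) * ?f t)\<bar>"
      by (simp add: abs_mult)
    also have "\<dots> \<le> integral {s..d} (\<lambda>t. E * sqrt s * (1 / sqrt t))"
    proof (rule Henstock_Kurzweil_Integration.integral_norm_bound_integral[where 'a=real, unfolded real_norm_def])
      show "(\<lambda>t. s powr (-2*\<beta>) * ?f t) integrable_on {s..d}"
        by (intro integrable_on_mult_right ig continuous_intros cont)
      show "(\<lambda>t. E * sqrt s * (1 / sqrt t)) integrable_on {s..d}"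
        using sq by blast
      fix t assume t: "t \<in> {s..d}"
      have "s powr (-2*\<beta>) * t powr (2*\<beta>) = (s/t) powr (-2*\<beta>)"
        using t s by (simp add: powr_divide powr_minus field_simps)
      also have "\<dots> \<le> (s/t) powr (1/2)"
        using False t s by (intro powr_mono') auto
      also have "\<dots> = sqrt s / sqrt t"
        using t s by (simp add: powr_half_sqrt real_sqrt_divide)
      finally have "(s powr (-2*\<beta>) * t powr (2*\<beta>)) * \<bar>g t - h t\<bar> \<le> sqrt s / sqrt t * E"
        using E[of t] E0 t s by (intro mult_mono) auto
      then show "\<bar>s powr (-2*\<beta>) * ?f t\<bar> \<le> E * sqrt s * (1 / sqrt t)"
        by (simp add: abs_mult mult_ac)
    qed
    also have "\<dots> = E * sqrt s * (2 * sqrt d - 2 * sqrt s)"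
      using sq by blast
    also have "\<dots> \<le> E * sqrt s * 2"
      proof (intro mult_left_mono)
      have "sqrt d \<le> 1" "0 \<le> sqrt s" using s by auto
      then show "2 * sqrt d - 2 * sqrt s \<le> 2" by linarith
    qed (use E0 s in auto)
    finally show ?thesis using False 1 by (simp add: primitive_bound_def mult_ac)
  qed
qed

lemma contraction_fixed_point_on_interval:
  fixes T :: "(real \<Rightarrow> real) \<Rightarrow> real \<Rightarrow> real"
  assumes "0 \<le> d"
    and cont: "\<And>z. continuous_on {0..d} z \<Longrightarrow> continuous_on {0..d} (T z)"
    and contr: "\<And>y z E. continuous_on {0..d} y \<Longrightarrow> continuous_on {0..d} z \<Longrightarrow>
       (\<And>x. x \<in> {0..d} \<Longrightarrow> \<bar>y x - z x\<bar> \<le> E) \<Longrightarrow>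
       (\<And>x. x \<in> {0..d} \<Longrightarrow> \<bar>T y x - T z x\<bar> \<le> E / 2)"
  obtains z where "continuous_on {0..d} z" "\<And>x. x \<in> {0..d} \<Longrightarrow> z x = T z x"
proof -
  \<comment> \<open>Clamping to \<open>{0..d}\<close> extends \<open>T z\<close> to a bounded
    continuous function on the whole line, where Banach's theorem applies to the complete type of
    such functions.\<close>
  define c where "c x = max 0 (min d x)" for x :: real
  have c: "c x \<in> {0..d}" for x using assms(1) by (auto simp: c_def)
  have c_id: "c x = x" if "x \<in> {0..d}" for x using that by (auto simp: c_def)
  have cc: "continuous_on UNIV c" unfolding c_def by (intro continuous_intros)
  define S where "S f = Bcontfun (\<lambda>x. T (apply_bcontfun f) (c x))" for f
  have S: "apply_bcontfun (S f) x = T (apply_bcontfun f) (c x)" for f x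
  proof -
    have T: "continuous_on {0..d} (T (apply_bcontfun f))" by (intro cont) auto
    have "(\<lambda>x. T (apply_bcontfun f) (c x)) \<in> bcontfun"
      unfolding bcontfun_def
    proof safe
      show "continuous_on UNIV (\<lambda>x. T (apply_bcontfun f) (c x))"
        by (rule continuous_on_compose2[OF T cc]) (use c in auto)
      have "range (\<lambda>x. T (apply_bcontfun f) (c x)) \<subseteq> T (apply_bcontfun f) ` {0..d}"
        using c by auto
      moreover have "bounded (T (apply_bcontfun f) ` {0..d})"
        by (intro compact_imp_bounded compact_continuous_image T) auto
      ultimately show "bounded (range (\<lambda>x. T (apply_bcontfun f) (c x)))"
        using bounded_subset by blast
    qed
    then show ?thesis by (simp add: S_def Bcontfun_inverse)
  qed
  have "\<forall>f g. dist (S f) (S g) \<le> 1/2 * dist f g"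
  proof (intro allI dist_bound)
    fix f g :: "real \<Rightarrow>\<^sub>C real" and x
    show "dist (apply_bcontfun (S f) x) (apply_bcontfun (S g) x) \<le> 1/2 * dist f g"
      unfolding S dist_real_def
      using contr[of "apply_bcontfun f" "apply_bcontfun g" "dist f g" "c x"] c[of x]
        dist_bounded[of f _ g] by (auto simp: dist_real_def)
  qed
  then have "\<exists>!f. S f = f" by (intro banach_fix_type[of "1/2"]) auto
  then obtain f where "S f = f" by blast
  then have "apply_bcontfun f x = T (apply_bcontfun f) x" if "x \<in> {0..d}" for x
    using S[of f x] c_id[OF that] by simp
  then show ?thesis by (intro that[of "apply_bcontfun f"]) auto
qed

text \<open>Since \<open>p < 1\<close>, the derivative of the power decreases, so its largest value
  on \<open>{a..}\<close> is taken at \<open>a\<close>.\<close>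

lemma powr_lipschitz_above:
  fixes a p x y :: real
  assumes "0 < a" "0 < p" "p < 1" "a \<le> x" "a \<le> y"
  shows "\<bar>x powr p - y powr p\<bar> \<le> p * a powr (p - 1) * \<bar>x - y\<bar>"
proof -
  have "norm (x powr p - y powr p) \<le> p * a powr (p - 1) * norm (x - y)"
  proof (rule field_differentiable_bound[where S = "{a..}"])
    show "((\<lambda>z. z powr p) has_field_derivative p * z powr (p - 1)) (at z within {a..})"
      if "z \<in> {a..}" for z
      using that assms by (intro has_real_derivative_powr[THEN has_field_derivative_at_within]) auto
    show "norm (p * z powr (p - 1)) \<le> p * a powr (p - 1)" if "z \<in> {a..}" for z
      using that assms by (auto intro!: mult_left_mono powr_mono2')
  qed (use assms in auto)
  then show ?thesis by simp
qed

section \<open>The first-order system in the boundary variable\<close>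

locale singular_ode =
  fixes \<beta> p \<tau> e D :: real
  assumes beta_neg: "\<beta> < 0" and p: "0 < p" "p < 1" and D: "0 < D" "D \<le> 1"
    and base_pos: "\<And>x. x \<in> {0..D} \<Longrightarrow> 0 < 1 + \<tau> * x"
begin

definition M :: "real \<Rightarrow> real" where "M x = (1 + \<tau> * x) powr e"

text \<open>The substitution \<open>w = M y\<close> removes the first-order term and creates the potential
  \<open>q = M'' / M - 2 (M' / M)\<^sup>2\<close>.\<close>

definition q :: "real \<Rightarrow> real" where "q x = - \<tau>\<^sup>2 * e * (e + 1) / (1 + \<tau> * x)\<^sup>2"

text \<open>The truncation at \<open>v / 2\<close> makes the nonlinearity globally Lipschitz in \<open>z\<close>, with a constant
  depending on \<open>v\<close> only; hence the interval of existence does not depend on \<open>c\<close>. It is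
  inactive near \<open>0\<close>, where \<open>z\<close> is close to \<open>v\<close>.\<close>

definition G :: "real \<Rightarrow> real \<Rightarrow> real \<Rightarrow> real" where
  "G v x z = - q x * z + M x powr (p - 1) * x powr ((p - 1) * \<beta>) * max z (v/2) powr p"

text \<open>The second-order equation is encoded as a system with the flux
  \<open>B = s powr (2*\<beta>) * z'\<close>. The parameter \<open>c\<close> fixes the flux at the
  base point of the weighted primitive: as a limit at 0, or as the value at
  \<open>d\<close>.\<close>

definition profile :: "real \<Rightarrow> real \<Rightarrow> real \<Rightarrow> (real \<Rightarrow> real) \<Rightarrow> (real \<Rightarrow> real) \<Rightarrow> bool" where
  "profile v d c z B \<longleftrightarrow>
     continuous_on {0..d} z \<and> z 0 = v \<and>
     (\<forall>s\<in>{0<..<d}. (z has_real_derivative s powr (-2*\<beta>) * B s) (at s) \<and>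
        (B has_real_derivative s powr (2*\<beta>) * G v s (z s)) (at s)) \<and>
     (if -1/2 < \<beta> then (B \<longlongrightarrow> c) (at_right 0) else continuous_on {0<..d} B \<and> B d = c)"

section \<open>Continuity and Lipschitz bounds for the right-hand side\<close>

lemma beta_mult_pos: "0 < (p - 1) * \<beta>"
  using p beta_neg by (simp add: mult_neg_neg)

lemma M_pos: "x \<in> {0..D} \<Longrightarrow> 0 < M x"
  using base_pos[of x] by (simp add: M_def)

lemma continuous_on_M: "continuous_on {0..D} M"
  unfolding M_def using base_pos by (intro continuous_intros) force+

lemma continuous_on_q: "continuous_on {0..D} q"
  unfolding q_def using base_pos by (intro continuous_intros) force+

text \<open>The exponent \<open>(p - 1) * \<beta>\<close> is positive, so the power of
  \<open>x\<close> tends to 0 at 0 and agrees there with the convention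
  \<open>0 powr a = 0\<close>.\<close>

lemma continuous_on_weight: "continuous_on {0..D} (\<lambda>x. M x powr (p - 1) * x powr ((p - 1) * \<beta>))"
  using M_pos beta_mult_pos
  by (intro continuous_on_mult continuous_on_powr' continuous_on_M continuous_intros) force+

lemma continuous_on_G:
  assumes "0 < v" "d \<le> D" "continuous_on {0..d} z"
  shows "continuous_on {0..d} (\<lambda>x. G v x (z x))"
proof -
  have "continuous_on {0..d} q" "continuous_on {0..d} (\<lambda>x. M x powr (p - 1) * x powr ((p - 1) * \<beta>))"
    using assms continuous_on_subset[OF continuous_on_q] continuous_on_subset[OF continuous_on_weight]
    by auto
  then show ?thesis
    unfolding G_def using assms
    by (intro continuous_on_add continuous_on_mult[OF continuous_on_minus]
        continuous_on_mult[of _ "\<lambda>x. M x powr (p - 1) * x powr ((p - 1) * \<beta>)"]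
        continuous_on_powr continuous_on_max continuous_on_const) auto
qed

lemma G_lipschitz:
  assumes "0 < v"
  obtains \<Lambda> where "0 < \<Lambda>"
    "\<And>x y z. x \<in> {0..D} \<Longrightarrow> \<bar>G v x y - G v x z\<bar> \<le> \<Lambda> * \<bar>y - z\<bar>"
proof -
  define W where "W x = M x powr (p - 1) * x powr ((p - 1) * \<beta>)" for x
  have "bounded (q ` {0..D})" "bounded (W ` {0..D})"
    unfolding W_def
    by (intro compact_imp_bounded compact_continuous_image continuous_on_q continuous_on_weight; simp)+
  then obtain Q1 Q2 where Q: "0 < Q1" "0 < Q2"
    "\<And>x. x \<in> {0..D} \<Longrightarrow> \<bar>q x\<bar> \<le> Q1" "\<And>x. x \<in> {0..D} \<Longrightarrow> \<bar>W x\<bar> \<le> Q2"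
    unfolding bounded_pos by (metis image_eqI real_norm_def)
  define L where "L = p * (v/2) powr (p - 1)"
  have L: "0 < L" using p assms by (simp add: L_def)
  show ?thesis
  proof (rule that[of "Q1 + Q2 * L"])
    show "0 < Q1 + Q2 * L" using Q L by (simp add: add_pos_pos)
    fix x y z assume x: "x \<in> {0..D}"
    have "\<bar>max y (v/2) powr p - max z (v/2) powr p\<bar> \<le> L * \<bar>max y (v/2) - max z (v/2)\<bar>"
      unfolding L_def using assms p by (intro powr_lipschitz_above) auto
    also have "\<dots> \<le> L * \<bar>y - z\<bar>"
      using L by (intro mult_left_mono) auto
    finally have *: "\<bar>max y (v/2) powr p - max z (v/2) powr p\<bar> \<le> L * \<bar>y - z\<bar>" .
    have "G v x y - G v x z = - q x * (y - z) + W x * (max y (v/2) powr p - max z (v/2) powr p)"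
      by (simp add: G_def W_def algebra_simps)
    also have "\<bar>\<dots>\<bar> \<le> \<bar>q x\<bar> * \<bar>y - z\<bar> + \<bar>W x\<bar> * \<bar>max y (v/2) powr p - max z (v/2) powr p\<bar>"
      by (rule order_trans[OF abs_triangle_ineq]) (simp add: abs_mult)
    also have "\<dots> \<le> Q1 * \<bar>y - z\<bar> + Q2 * (L * \<bar>y - z\<bar>)"
      using Q x * L by (intro add_mono mult_mono) auto
    finally show "\<bar>G v x y - G v x z\<bar> \<le> (Q1 + Q2 * L) * \<bar>y - z\<bar>"
      by (simp add: algebra_simps)
  qed
qed

text \<open>Integrating the system twice gives a fixed point equation for \<open>z\<close>. The
  length \<open>d\<close> is chosen before \<open>c\<close>, so that profiles with different
  parameters live on one interval and can be compared.\<close>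

lemma profile_exists:
  assumes "0 < v"
  obtains d where "0 < d" "d \<le> D" "\<And>c. \<exists>z B. profile v d c z B"
proof -
  obtain \<Lambda> where \<Lambda>: "0 < \<Lambda>"
    "\<And>x y z. x \<in> {0..D} \<Longrightarrow> \<bar>G v x y - G v x z\<bar> \<le> \<Lambda> * \<bar>y - z\<bar>"
    using G_lipschitz[OF assms] by blast
  define m where "m = primitive_bound \<beta> * \<Lambda>"
  have m: "0 < m" using \<Lambda> primitive_bound_pos by (simp add: m_def)
  \<comment> \<open>The integrand of \<open>T\<close> has Lipschitz constant at most
    \<open>m\<close>, so \<open>T\<close> has at most \<open>d * m \<le> 1/2\<close>;
    \<open>d \<le> 1\<close> comes from \<open>D\<close>.\<close>
  define d where "d = min D (1 / (2 * m))"
  have d: "0 < d" "d \<le> D" "d \<le> 1" using D m by (auto simp: d_def)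
  have "d * m \<le> 1 / (2 * m) * m" using m by (intro mult_right_mono) (auto simp: d_def)
  then have dm: "d * m \<le> 1/2" using m by simp
  have "\<exists>z B. profile v d c z B" for c
  proof -
    define B where "B z s = c + weighted_primitive \<beta> d (\<lambda>t. G v t (z t)) s" for z s
    define I where "I z s = s powr (-2*\<beta>) * B z s" for z s
    define T where "T z x = v + integral {0..x} (I z)" for z x
    have Gc: "continuous_on {0..d} (\<lambda>t. G v t (z t))" if "continuous_on {0..d} z" for z
      using that d assms by (intro continuous_on_G) auto
    have Bd: "(B z has_real_derivative s powr (2*\<beta>) * G v s (z s)) (at s within {0..d})"
      if "continuous_on {0..d} z" "0 < s" "s \<le> d" for z s
      unfolding B_def
      by (auto intro!: derivative_eq_intros weighted_primitive_has_derivative_within Gc that)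
    have Ic: "continuous_on {0..d} (I z)" if z: "continuous_on {0..d} z" for z
      unfolding continuous_on_eq_continuous_within
    proof
      fix s assume s: "s \<in> {0..d}"
      show "continuous (at s within {0..d}) (I z)"
      proof (cases "s = 0")
        case False
        then have "continuous (at s within {0..d}) (B z)"
          using s by (intro DERIV_continuous[OF Bd] z) auto
        with False show ?thesis unfolding I_def by (intro continuous_intros) auto
      next
        case True
        have "bounded ((\<lambda>t. G v t (z t)) ` {0..d})"
          by (intro compact_imp_bounded compact_continuous_image Gc z) auto
        then obtain E where E: "\<And>t. t \<in> {0..d} \<Longrightarrow> \<bar>G v t (z t)\<bar> \<le> E"
          unfolding bounded_iff by (metis image_eqI real_norm_def)
        \<comment> \<open>As \<open>0 powr a = 0\<close>, the value of \<open>I z\<close> at 0 is 0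
          and continuity there is a null limit. Comparison of the right-hand side with the zero
          function in \<open>weighted_primitive_bound\<close> supplies the majorant.\<close>
        have "(I z \<longlongrightarrow> 0) (at 0 within {0..d})"
        proof (rule Lim_null_comparison)
          have "norm (I z x) \<le> x powr (-2*\<beta>) * \<bar>c\<bar> + primitive_bound \<beta> * E * sqrt x"
            if "x \<in> {0..d}" "x \<noteq> 0" for x
          proof -
            have "x powr (-2*\<beta>) * \<bar>weighted_primitive \<beta> d (\<lambda>t. G v t (z t)) x
                - weighted_primitive \<beta> d (\<lambda>t. 0) x\<bar> \<le> primitive_bound \<beta> * E * sqrt x"
              using that d E by (intro weighted_primitive_bound Gc z) auto
            then have "x powr (-2*\<beta>) * \<bar>weighted_primitive \<beta> d (\<lambda>t. G v t (z t)) x\<bar>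
                \<le> primitive_bound \<beta> * E * sqrt x"
              by (simp add: weighted_primitive_zero)
            moreover have "norm (I z x) \<le>
                x powr (-2*\<beta>) * (\<bar>c\<bar> + \<bar>weighted_primitive \<beta> d (\<lambda>t. G v t (z t)) x\<bar>)"
              unfolding I_def B_def real_norm_def abs_mult by (intro mult_mono) auto
            ultimately show ?thesis by (simp add: distrib_left)
          qed
          then show "\<forall>\<^sub>F x in at 0 within {0..d}.
              norm (I z x) \<le> x powr (-2*\<beta>) * \<bar>c\<bar> + primitive_bound \<beta> * E * sqrt x"
            by (auto simp: eventually_at_filter)
          have "continuous_on {0..d} (\<lambda>x. x powr (-2*\<beta>) * \<bar>c\<bar> + primitive_bound \<beta> * E * sqrt x)"
            using beta_neg by (intro continuous_intros continuous_on_powr') auto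
          from this[unfolded continuous_on_def, rule_format, of 0]
          show "((\<lambda>x. x powr (-2*\<beta>) * \<bar>c\<bar> + primitive_bound \<beta> * E * sqrt x) \<longlongrightarrow> 0)
              (at 0 within {0..d})"
            using d by simp
        qed
        then show ?thesis using True by (simp add: continuous_within I_def)
      qed
    qed
    have Ii: "I z integrable_on {0..x}" if "continuous_on {0..d} z" "x \<in> {0..d}" for z x
      using that by (intro integrable_continuous_real continuous_on_subset[OF Ic]) auto
    have contr: "\<bar>T y x - T z x\<bar> \<le> E / 2"
      if y: "continuous_on {0..d} y" and z: "continuous_on {0..d} z" and x: "x \<in> {0..d}"
        and E: "\<And>x. x \<in> {0..d} \<Longrightarrow> \<bar>y x - z x\<bar> \<le> E" for y z E x
    proof -
      have E0: "0 \<le> E" using E[OF x] by linarith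
      have "T y x - T z x = integral {0..x} (\<lambda>s. I y s - I z s)"
        unfolding T_def using x y z by (simp add: Ii Henstock_Kurzweil_Integration.integral_diff)
      also have "\<bar>\<dots>\<bar> \<le> integral {0..x} (\<lambda>s. m * E)"
      proof (rule Henstock_Kurzweil_Integration.integral_norm_bound_integral[where 'a=real, unfolded real_norm_def])
        fix s assume s: "s \<in> {0..x}"
        show "\<bar>I y s - I z s\<bar> \<le> m * E"
        proof (cases "s = 0")
          case True
          then show ?thesis using m E0 by (simp add: I_def)
        next
          case False
          have "\<bar>I y s - I z s\<bar> = s powr (-2*\<beta>) * \<bar>weighted_primitive \<beta> d (\<lambda>t. G v t (y t)) s
                - weighted_primitive \<beta> d (\<lambda>t. G v t (z t)) s\<bar>"
            by (simp add: I_def B_def right_diff_distrib[symmetric] abs_mult)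
          also have "\<dots> \<le> primitive_bound \<beta> * (\<Lambda> * E) * sqrt s"
          proof (rule weighted_primitive_bound)
            fix t assume t: "t \<in> {0..d}"
            have "\<bar>G v t (y t) - G v t (z t)\<bar> \<le> \<Lambda> * \<bar>y t - z t\<bar>"
              using \<Lambda>(2) t d by auto
            also have "\<dots> \<le> \<Lambda> * E" using E[OF t] \<Lambda>(1) by (intro mult_left_mono) auto
            finally show "\<bar>G v t (y t) - G v t (z t)\<bar> \<le> \<Lambda> * E" .
          qed (use s x d False Gc y z in auto)
          also have "\<dots> = m * E * sqrt s" by (simp add: m_def)
          also have "\<dots> \<le> m * E * 1"
            using m E0 s x d by (intro mult_left_mono) auto
          finally show ?thesis by simp
        qed
      qed (use x y z in \<open>auto intro!: Ii integrable_diff\<close>)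
      also have "\<dots> = x * (m * E)" using x by simp
      also have "\<dots> \<le> d * (m * E)" using x m E0 by (intro mult_right_mono) auto
      also have "\<dots> = (d * m) * E" by simp
      also have "\<dots> \<le> 1/2 * E" using dm E0 by (rule mult_right_mono)
      finally show ?thesis by simp
    qed
    have Tc: "continuous_on {0..d} (T z)" if "continuous_on {0..d} z" for z
      unfolding T_def using d
      by (intro continuous_intros indefinite_integral_continuous_1 Ii that) auto
    obtain z where z: "continuous_on {0..d} z" and fp: "\<And>x. x \<in> {0..d} \<Longrightarrow> z x = T z x"
      using contraction_fixed_point_on_interval[of d T] contr Tc d by (metis less_imp_le)
    have int: "at s within {0..d} = at s" if "s \<in> {0<..<d}" for s
      using that by (intro at_within_interior) auto
    have "profile v d c z (B z)"
      unfolding profile_def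
    proof (intro conjI ballI)
      show "z 0 = v" using fp[of 0] d by (simp add: T_def)
      fix s assume s: "s \<in> {0<..<d}"
      have "(T z has_real_derivative 0 + I z s) (at s within {0..d})"
        unfolding T_def using s
        by (intro DERIV_add DERIV_const integral_has_real_derivative Ic z) auto
      then have "(z has_real_derivative 0 + I z s) (at s within {0..d})"
        by (rule has_field_derivative_transform_within[where d=1])
          (use s in \<open>auto simp: fp[symmetric]\<close>)
      then show "(z has_real_derivative s powr (-2*\<beta>) * B z s) (at s)"
        using int[OF s] by (simp add: I_def)
      show "(B z has_real_derivative s powr (2*\<beta>) * G v s (z s)) (at s)"
        using Bd[OF z, of s] s int[OF s] by simp
    next
      show "if -1/2 < \<beta> then (B z \<longlongrightarrow> c) (at_right 0)
        else continuous_on {0<..d} (B z) \<and> B z d = c"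
      proof (cases "-1/2 < \<beta>")
        case True
        \<comment> \<open>With base point 0 the primitive vanishes in the limit, leaving exactly
          \<open>c\<close>.\<close>
        have "continuous_on {0..d} (\<lambda>s. integral {0..s} (\<lambda>t. t powr (2*\<beta>) * G v t (z t)))"
          using True d
          by (intro indefinite_integral_continuous_1 integrable_on_powr_mult_continuous Gc z) auto
        then have "((\<lambda>s. integral {0..s} (\<lambda>t. t powr (2*\<beta>) * G v t (z t))) \<longlongrightarrow> 0) (at_right 0)"
          using d by (auto simp: continuous_on_def at_within_Icc_at_right dest!: bspec[of _ _ 0])
        then have "(B z \<longlongrightarrow> c + 0) (at_right 0)"
          unfolding B_def weighted_primitive_def using True by (intro tendsto_intros) auto
        with True show ?thesis by simp
      next
        case False
        have "continuous_on {0<..d} (B z)"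
          unfolding continuous_on_eq_continuous_within
        proof
          fix s assume "s \<in> {0<..d}"
          then show "continuous (at s within {0<..d}) (B z)"
            by (intro continuous_within_subset[OF DERIV_continuous[OF Bd]] z) auto
        qed
        with False show ?thesis by (simp add: B_def weighted_primitive_def)
      qed
    qed (rule z)
    then show ?thesis by blast
  qed
  with d that show ?thesis by blast
qed

section \<open>Recovering the parameter from the germ of a profile\<close>

lemma profileD:
  assumes "profile v d c z B"
  shows "continuous_on {0..d} z" "z 0 = v"
    "\<And>s. s \<in> {0<..<d} \<Longrightarrow> (z has_real_derivative s powr (-2*\<beta>) * B s) (at s)"
    "\<And>s. s \<in> {0<..<d} \<Longrightarrow> (B has_real_derivative s powr (2*\<beta>) * G v s (z s)) (at s)"
    "-1/2 < \<beta> \<Longrightarrow> (B \<longlongrightarrow> c) (at_right 0)"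
    "\<beta> \<le> -1/2 \<Longrightarrow> continuous_on {0<..d} B" "\<beta> \<le> -1/2 \<Longrightarrow> B d = c"
  using assms by (auto simp: profile_def)

text \<open>When the weight is not integrable at \<open>0\<close>, \<open>c\<close> is the value of \<open>B\<close> at \<open>d\<close> and cannot be read off
  the germ of \<open>z\<close> directly: a Gronwall argument for \<open>(z - z', B - B')\<close> propagates equality
  from the germ to \<open>d\<close>.\<close>

lemma profile_parameter_unique:
  assumes v: "0 < v" and d: "0 < d" "d \<le> D"
    and P: "profile v d c z B" and P': "profile v d c' z' B'"
    and ev: "\<forall>\<^sub>F s in at_right 0. z s = z' s"
  shows "c = c'"
proof -
  note z = profileD[OF P] and z' = profileD[OF P']
  obtain b where b: "0 < b" "\<And>s. 0 < s \<Longrightarrow> s < b \<Longrightarrow> z s = z' s"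
    using ev by (auto simp: eventually_at_right_field)
  define a where "a = min b d"
  have a: "0 < a" "a \<le> d" "\<And>s. s \<in> {0<..<a} \<Longrightarrow> z s = z' s"
    using b d by (auto simp: a_def)
  \<comment> \<open>The first equation of the system determines the flux from the derivative of
    \<open>z\<close>.\<close>
  have BB: "B s = B' s" if s: "s \<in> {0<..<a}" for s
  proof -
    have "(z has_real_derivative s powr (-2*\<beta>) * B' s) (at s)"
      by (rule has_field_derivative_transform_within_open[OF z'(3), of s "{0<..<a}"])
        (use s a in auto)
    moreover have "(z has_real_derivative s powr (-2*\<beta>) * B s) (at s)"
      using z(3) s a by auto
    ultimately have "s powr (-2*\<beta>) * B' s = s powr (-2*\<beta>) * B s"
      by (rule DERIV_unique)
    with s show ?thesis by simp
  qed
  show ?thesis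
  proof (cases "-1/2 < \<beta>")
    case True
    have "\<forall>\<^sub>F s in at_right 0. B s = B' s"
      using BB a(1) by (auto simp: eventually_at_right_field)
    then have "(B' \<longlongrightarrow> c) (at_right 0)"
      using tendsto_cong z(5)[OF True] by blast
    then show ?thesis using z'(5)[OF True] tendsto_unique[OF trivial_limit_at_right_real] by blast
  next
    case False
    obtain \<Lambda> where \<Lambda>: "0 < \<Lambda>"
      "\<And>x y z. x \<in> {0..D} \<Longrightarrow> \<bar>G v x y - G v x z\<bar> \<le> \<Lambda> * \<bar>y - z\<bar>"
      using G_lipschitz[OF v] by blast
    define r where "r = a / 2"
    have r: "0 < r" "r < d" "r \<in> {0<..<a}" using a by (auto simp: r_def)
    \<comment> \<open>Starting at \<open>r > 0\<close> bounds the singular weight by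
      \<open>r powr (2*\<beta>)\<close>, while the other one is at most 1 because
      \<open>t \<le> 1\<close>. With \<open>2 * \<bar>x\<bar> * \<bar>y\<bar> \<le> x\<^sup>2 +
      y\<^sup>2\<close> this makes the derivative of \<open>E\<close> at most
      \<open>k * E\<close>.\<close>
    define k where "k = 1 + \<Lambda> * r powr (2*\<beta>)"
    define E where "E s = (z s - z' s)\<^sup>2 + (B s - B' s)\<^sup>2" for s
    have E0: "E s = 0" if s: "s \<in> {r<..<d}" for s
    proof -
      have "E s * exp (- k * s) \<le> E r * exp (- k * r)"
      proof (rule DERIV_nonpos_imp_nonincreasing[where f = "\<lambda>s. E s * exp (- k * s)"])
        show "r \<le> s" using s by simp
        fix t assume t: "r \<le> t" "t \<le> s"
        define x y g where "x = z t - z' t" and "y = B t - B' t"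
          and "g = G v t (z t) - G v t (z' t)"
        have td: "t \<in> {0<..<d}" using t r s by auto
        have dE: "(E has_real_derivative 2 * x * (t powr (-2*\<beta>) * y) + 2 * y * (t powr (2*\<beta>) * g)) (at t)"
          unfolding E_def
          by (rule derivative_eq_intros z(3,4) z'(3,4) td refl)+
            (simp add: x_def y_def g_def algebra_simps)
        have "t powr (-2*\<beta>) \<le> 1 powr (-2*\<beta>)"
          using td d D beta_neg by (intro powr_mono2) auto
        then have t1: "t powr (-2*\<beta>) \<le> 1" by simp
        have t2: "t powr (2*\<beta>) \<le> r powr (2*\<beta>)"
          using t r beta_neg by (intro powr_mono2') auto
        have g: "\<bar>g\<bar> \<le> \<Lambda> * \<bar>x\<bar>" unfolding g_def x_def using \<Lambda>(2) td d by auto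
        have "2 * x * (t powr (-2*\<beta>) * y) \<le> \<bar>2 * x * (t powr (-2*\<beta>) * y)\<bar>" by simp
        also have "\<dots> = 2 * \<bar>x\<bar> * \<bar>y\<bar> * t powr (-2*\<beta>)" by (simp add: abs_mult)
        also have "\<dots> \<le> 2 * \<bar>x\<bar> * \<bar>y\<bar> * 1" using t1 by (intro mult_left_mono) auto
        finally have 1: "2 * x * (t powr (-2*\<beta>) * y) \<le> 2 * \<bar>x\<bar> * \<bar>y\<bar>" by simp
        have "2 * y * (t powr (2*\<beta>) * g) \<le> \<bar>2 * y * (t powr (2*\<beta>) * g)\<bar>" by simp
        also have "\<dots> = 2 * \<bar>y\<bar> * (t powr (2*\<beta>) * \<bar>g\<bar>)" by (simp add: abs_mult)
        also have "\<dots> \<le> 2 * \<bar>y\<bar> * (r powr (2*\<beta>) * (\<Lambda> * \<bar>x\<bar>))"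
          using t2 g by (intro mult_left_mono mult_mono) auto
        finally have 2: "2 * y * (t powr (2*\<beta>) * g) \<le> \<Lambda> * r powr (2*\<beta>) * (2 * \<bar>x\<bar> * \<bar>y\<bar>)"
          by (simp add: mult_ac)
        have "2 * x * (t powr (-2*\<beta>) * y) + 2 * y * (t powr (2*\<beta>) * g) \<le> k * (2 * \<bar>x\<bar> * \<bar>y\<bar>)"
          using 1 2 by (simp add: k_def algebra_simps)
        also have "\<dots> \<le> k * (x\<^sup>2 + y\<^sup>2)"
          using sum_squares_bound[of "\<bar>x\<bar>" "\<bar>y\<bar>"] \<Lambda>(1) by (intro mult_left_mono) (auto simp: k_def)
        finally have "2 * x * (t powr (-2*\<beta>) * y) + 2 * y * (t powr (2*\<beta>) * g) - k * E t \<le> 0"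
          by (simp add: E_def x_def y_def)
        moreover have "((\<lambda>s. E s * exp (- k * s)) has_real_derivative
            (2 * x * (t powr (-2*\<beta>) * y) + 2 * y * (t powr (2*\<beta>) * g) - k * E t) * exp (- k * t)) (at t)"
          by (rule derivative_eq_intros dE refl)+ (simp add: algebra_simps)
        ultimately show "\<exists>y'. ((\<lambda>s. E s * exp (- k * s)) has_real_derivative y') (at t) \<and> y' \<le> 0"
          by (meson exp_ge_zero mult_nonpos_nonneg)
      qed
      also have "E r = 0" unfolding E_def using a(3) BB r by simp
      finally have "E s \<le> 0" by (simp add: mult_le_0_iff)
      then show ?thesis unfolding E_def by (smt (verit) zero_le_power2)
    qed
    \<comment> \<open>The system holds on the open interval only; continuity carries the equality of
      the fluxes to \<open>d\<close>, where they equal the parameters.\<close>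
    have "B d - B' d = 0"
    proof (rule continuous_constant_on_closure[where S = "{r<..<d}" and f = "\<lambda>s. B s - B' s"])
      show "continuous_on (closure {r<..<d}) (\<lambda>s. B s - B' s)"
        using False r by (intro continuous_intros continuous_on_subset[OF z(6)]
            continuous_on_subset[OF z'(6)]) auto
      show "B s - B' s = 0" if "s \<in> {r<..<d}" for s
        using E0[OF that] by (simp add: E_def sum_power2_eq_zero_iff)
    qed (use r in auto)
    with False z(7) z'(7) show ?thesis by auto
  qed
qed

section \<open>Asymptotic expansion\<close>

lemma profile_tendsto:
  assumes "0 < d" "profile v d c z B"
  shows "(z \<longlongrightarrow> v) (at_right 0)"
proof -
  have "(z \<longlongrightarrow> z 0) (at 0 within {0..d})"
    using profileD(1)[OF assms(2)] assms(1) by (auto simp: continuous_on_def)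
  then show ?thesis using assms profileD(2)[OF assms(2)] by (simp add: at_within_Icc_at_right)
qed

text \<open>The nonlinear term carries a positive power of \<open>s\<close> and dies at 0, so only
  the potential survives.\<close>

lemma profile_rhs_tendsto:
  assumes "0 < v" "0 < d" "d \<le> D" "profile v d c z B"
  shows "((\<lambda>s. G v s (z s)) \<longlongrightarrow> - q 0 * v) (at_right 0)"
proof -
  have "continuous_on {0..d} (\<lambda>s. G v s (z s))"
    using assms profileD(1) by (intro continuous_on_G) auto
  then have "((\<lambda>s. G v s (z s)) \<longlongrightarrow> G v 0 (z 0)) (at 0 within {0..d})"
    using assms(2) by (auto simp: continuous_on_def)
  then show ?thesis using assms profileD(2)[OF assms(4)] by (simp add: at_within_Icc_at_right G_def)
qed

text \<open>The flux has the finite limit \<open>c\<close>, so a single use of l'Hospital's rule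
  suffices.\<close>

lemma profile_asymptotics_gt:
  assumes "-1/2 < \<beta>" "0 < d" "profile v d c z B"
  shows "((\<lambda>s. (z s - v) / s powr (1 - 2*\<beta>)) \<longlongrightarrow> c / (1 - 2*\<beta>)) (at_right 0)"
proof (rule lhopital_right_0[where f' = "\<lambda>s. s powr (-2*\<beta>) * B s"
      and g' = "\<lambda>s. (1 - 2*\<beta>) * s powr (-2*\<beta>)"])
  note z = profileD[OF assms(3)]
  show "((\<lambda>s. z s - v) \<longlongrightarrow> 0) (at_right 0)"
    using tendsto_diff[OF profile_tendsto[OF assms(2,3)] tendsto_const[of v]] by simp
  show "((\<lambda>s. s powr (1 - 2*\<beta>)) \<longlongrightarrow> 0) (at_right 0)"
    using beta_neg by real_asymp
  show "\<forall>\<^sub>F s in at_right 0. s powr (1 - 2*\<beta>) \<noteq> 0"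
    "\<forall>\<^sub>F s in at_right 0. (1 - 2*\<beta>) * s powr (-2*\<beta>) \<noteq> 0"
    using beta_neg by (auto simp: eventually_at_right_field intro!: exI[of _ 1])
  show "\<forall>\<^sub>F s in at_right 0. ((\<lambda>s. z s - v) has_real_derivative s powr (-2*\<beta>) * B s) (at s)"
    using eventually_at_right_real[OF assms(2)]
    by eventually_elim (auto intro!: derivative_eq_intros z(3))
  show "\<forall>\<^sub>F s in at_right 0.
      ((\<lambda>s. s powr (1 - 2*\<beta>)) has_real_derivative (1 - 2*\<beta>) * s powr (-2*\<beta>)) (at s)"
    using eventually_at_right_real[OF assms(2)]
    by eventually_elim (auto intro!: derivative_eq_intros)
  have "((\<lambda>s. B s / (1 - 2*\<beta>)) \<longlongrightarrow> c / (1 - 2*\<beta>)) (at_right 0)"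
    using assms(1) beta_neg by (intro tendsto_intros z(5)) auto
  then show "((\<lambda>s. s powr (-2*\<beta>) * B s / ((1 - 2*\<beta>) * s powr (-2*\<beta>))) \<longlongrightarrow> c / (1 - 2*\<beta>))
      (at_right 0)"
    by (rule Lim_transform_eventually)
      (auto simp: eventually_at_right_field intro!: exI[of _ 1])
qed

text \<open>Here \<open>B' = G / s\<close>, so the flux is compared with a logarithm first. The
  scale \<open>-(2 * ln s + 1)\<close> is the factor left when \<open>-(s\<^sup>2 * ln s)\<close> is
  differentiated and \<open>s\<close> is divided out.\<close>

lemma profile_asymptotics_eq:
  assumes "\<beta> = -1/2" "0 < v" "0 < d" "d \<le> D" "profile v d c z B"
  shows "((\<lambda>s. (z s - v) / (s\<^sup>2 * \<bar>ln s\<bar>)) \<longlongrightarrow> q 0 * v / 2) (at_right 0)"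
proof -
  note z = profileD[OF assms(5)]
  have ev: "\<forall>\<^sub>F s in at_right 0. s \<in> {0<..<d} \<and> s < exp (-1)"
    using eventually_conj[OF eventually_at_right_real[OF assms(3)] eventually_at_right_real[of 0 "exp (-1)"]]
    by (auto elim: eventually_mono)
  \<comment> \<open>Below \<open>exp (-1)\<close> the logarithm is less than -1, which fixes the
    sign of both denominators and of \<open>\<bar>ln s\<bar>\<close>.\<close>
  have ln: "2 * ln s + 1 < 0" if "0 < s" "s < exp (-1)" for s :: real
    using ln_less_cancel_iff[of s "exp (-1)"] that by simp
  have 1: "((\<lambda>s. B s / (- (2 * ln s + 1))) \<longlongrightarrow> q 0 * v / 2) (at_right 0)"
  proof (rule lhopital_right_0_at_top[where f' = "\<lambda>s. s powr (2*\<beta>) * G v s (z s)" and g' = "\<lambda>s. - 2 / s"])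
    show "LIM s at_right 0. - (2 * ln s + 1 :: real) :> at_top" by real_asymp
    show "\<forall>\<^sub>F s in at_right 0. - 2 / s \<noteq> (0::real)"
      by (auto simp: eventually_at_right_field intro!: exI[of _ 1])
    show "\<forall>\<^sub>F s in at_right 0. (B has_real_derivative s powr (2*\<beta>) * G v s (z s)) (at s)"
      using eventually_at_right_real[OF assms(3)] by eventually_elim (rule z(4))
    show "\<forall>\<^sub>F s in at_right 0. ((\<lambda>s. - (2 * ln s + 1)) has_real_derivative - 2 / s) (at s)"
      using eventually_at_right_real[OF assms(3)]
      by eventually_elim (auto intro!: derivative_eq_intros)
    have "((\<lambda>s. - (G v s (z s) / 2)) \<longlongrightarrow> - ((- q 0 * v) / 2)) (at_right 0)"
      by (intro tendsto_intros profile_rhs_tendsto[OF assms(2-5)]) auto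
    then show "((\<lambda>s. s powr (2*\<beta>) * G v s (z s) / (- 2 / s)) \<longlongrightarrow> q 0 * v / 2) (at_right 0)"
    proof (rule Lim_transform_eventually[THEN tendsto_eq_rhs])
      show "\<forall>\<^sub>F s in at_right 0. - (G v s (z s) / 2) = s powr (2*\<beta>) * G v s (z s) / (- 2 / s)"
        using ev by eventually_elim (simp add: assms(1) powr_minus field_simps)
    qed simp
  qed
  have "((\<lambda>s. (z s - v) / (- (s\<^sup>2 * ln s))) \<longlongrightarrow> q 0 * v / 2) (at_right 0)"
  proof (rule lhopital_right_0[where f' = "\<lambda>s. s powr (-2*\<beta>) * B s" and g' = "\<lambda>s. - (s * (2 * ln s + 1))"])
    show "((\<lambda>s. z s - v) \<longlongrightarrow> 0) (at_right 0)"
      using tendsto_diff[OF profile_tendsto[OF assms(3,5)] tendsto_const[of v]] by simp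
    show "((\<lambda>s::real. - (s\<^sup>2 * ln s)) \<longlongrightarrow> 0) (at_right 0)" by real_asymp
    show "\<forall>\<^sub>F s in at_right 0. - (s\<^sup>2 * ln s) \<noteq> (0::real)"
      using ev by eventually_elim (use ln in force)
    show "\<forall>\<^sub>F s in at_right 0. - (s * (2 * ln s + 1)) \<noteq> (0::real)"
      using ev by eventually_elim (use ln in force)
    show "\<forall>\<^sub>F s in at_right 0. ((\<lambda>s. z s - v) has_real_derivative s powr (-2*\<beta>) * B s) (at s)"
      using eventually_at_right_real[OF assms(3)]
      by eventually_elim (auto intro!: derivative_eq_intros z(3))
    show "\<forall>\<^sub>F s in at_right 0.
        ((\<lambda>s. - (s\<^sup>2 * ln s)) has_real_derivative - (s * (2 * ln s + 1))) (at s)"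
      using eventually_at_right_real[OF assms(3)]
      by eventually_elim (auto intro!: derivative_eq_intros simp: field_simps power2_eq_square)
    show "((\<lambda>s. s powr (-2*\<beta>) * B s / (- (s * (2 * ln s + 1)))) \<longlongrightarrow> q 0 * v / 2) (at_right 0)"
    proof (rule Lim_transform_eventually[OF 1])
      show "\<forall>\<^sub>F s in at_right 0.
          B s / (- (2 * ln s + 1)) = s powr (-2*\<beta>) * B s / (- (s * (2 * ln s + 1)))"
        using ev
      proof eventually_elim
        case (elim s)
        then show ?case using ln[of s] by (simp add: assms(1) divide_simps) algebra
      qed
    qed
  qed
  then show ?thesis
  proof (rule Lim_transform_eventually)
    show "\<forall>\<^sub>F s in at_right 0. (z s - v) / (- (s\<^sup>2 * ln s)) = (z s - v) / (s\<^sup>2 * \<bar>ln s\<bar>)"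
      using ev
    proof eventually_elim
      case (elim s)
      then have "\<bar>ln s\<bar> = - ln s" using ln[of s] by simp
      then show ?case by simp
    qed
  qed
qed

text \<open>Since \<open>2*\<beta> + 1 < 0\<close>, the scale \<open>s powr (2*\<beta> + 1)\<close>
  for the flux tends to infinity and swamps the constant of integration; hence \<open>c\<close> is
  absent from the limit.\<close>

lemma profile_asymptotics_less:
  assumes "\<beta> < -1/2" "0 < v" "0 < d" "d \<le> D" "profile v d c z B"
  shows "((\<lambda>s. (z s - v) / s\<^sup>2) \<longlongrightarrow> - q 0 * v / (2 * (2*\<beta> + 1))) (at_right 0)"
proof -
  note z = profileD[OF assms(5)]
  note ev = eventually_at_right_real[OF assms(3)]
  have b: "2*\<beta> + 1 < 0" using assms(1) by simp
  have 1: "((\<lambda>s. B s / s powr (2*\<beta> + 1)) \<longlongrightarrow> - q 0 * v / (2*\<beta> + 1)) (at_right 0)"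
  proof (rule lhopital_right_0_at_top[where f' = "\<lambda>s. s powr (2*\<beta>) * G v s (z s)"
        and g' = "\<lambda>s. (2*\<beta> + 1) * s powr (2*\<beta>)"])
    show "LIM s at_right 0. s powr (2*\<beta> + 1) :> at_top" using b by real_asymp
    show "\<forall>\<^sub>F s in at_right 0. (2*\<beta> + 1) * s powr (2*\<beta>) \<noteq> 0"
      using ev by eventually_elim (use b in auto)
    show "\<forall>\<^sub>F s in at_right 0. (B has_real_derivative s powr (2*\<beta>) * G v s (z s)) (at s)"
      using ev by eventually_elim (rule z(4))
    show "\<forall>\<^sub>F s in at_right 0.
        ((\<lambda>s. s powr (2*\<beta> + 1)) has_real_derivative (2*\<beta> + 1) * s powr (2*\<beta>)) (at s)"
      using ev by eventually_elim (auto intro!: derivative_eq_intros)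
    have "((\<lambda>s. G v s (z s) / (2*\<beta> + 1)) \<longlongrightarrow> (- q 0 * v) / (2*\<beta> + 1)) (at_right 0)"
      using b by (intro tendsto_intros profile_rhs_tendsto[OF assms(2-5)]) auto
    then show "((\<lambda>s. s powr (2*\<beta>) * G v s (z s) / ((2*\<beta> + 1) * s powr (2*\<beta>))) \<longlongrightarrow>
        - q 0 * v / (2*\<beta> + 1)) (at_right 0)"
    proof (rule Lim_transform_eventually)
      show "\<forall>\<^sub>F s in at_right 0. G v s (z s) / (2*\<beta> + 1) =
          s powr (2*\<beta>) * G v s (z s) / ((2*\<beta> + 1) * s powr (2*\<beta>))"
        using ev by eventually_elim simp
    qed
  qed
  show ?thesis
  proof (rule lhopital_right_0[where f' = "\<lambda>s. s powr (-2*\<beta>) * B s" and g' = "\<lambda>s. 2 * s"])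
    show "((\<lambda>s. z s - v) \<longlongrightarrow> 0) (at_right 0)"
      using tendsto_diff[OF profile_tendsto[OF assms(3,5)] tendsto_const[of v]] by simp
    show "((\<lambda>s::real. s\<^sup>2) \<longlongrightarrow> 0) (at_right 0)" by real_asymp
    show "\<forall>\<^sub>F s in at_right 0. s\<^sup>2 \<noteq> (0::real)" "\<forall>\<^sub>F s in at_right 0. 2 * s \<noteq> (0::real)"
      using ev by (eventually_elim; simp)+
    show "\<forall>\<^sub>F s in at_right 0. ((\<lambda>s. z s - v) has_real_derivative s powr (-2*\<beta>) * B s) (at s)"
      using ev by eventually_elim (auto intro!: derivative_eq_intros z(3))
    show "\<forall>\<^sub>F s in at_right 0. ((\<lambda>s::real. s\<^sup>2) has_real_derivative 2 * s) (at s)"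
      by (auto intro!: always_eventually derivative_eq_intros)
    have "((\<lambda>s. B s / s powr (2*\<beta> + 1) / 2) \<longlongrightarrow> - q 0 * v / (2*\<beta> + 1) / 2) (at_right 0)"
      by (intro tendsto_intros 1) auto
    then show "((\<lambda>s. s powr (-2*\<beta>) * B s / (2 * s)) \<longlongrightarrow> - q 0 * v / (2 * (2*\<beta> + 1))) (at_right 0)"
    proof (rule Lim_transform_eventually[THEN tendsto_eq_rhs])
      show "\<forall>\<^sub>F s in at_right 0. B s / s powr (2*\<beta> + 1) / 2 = s powr (-2*\<beta>) * B s / (2 * s)"
        using ev by eventually_elim (simp add: powr_add powr_minus field_simps)
    qed (simp add: field_simps)
  qed
qed

section \<open>Second-order Taylor expansion of the Liouville factor\<close>

lemma M_has_derivative: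
  assumes "x \<in> {0..D}"
  shows "((\<lambda>x. (1 + \<tau> * x) powr a) has_real_derivative a * \<tau> * (1 + \<tau> * x) powr (a - 1)) (at x)"
  using base_pos[OF assms] by (auto intro!: derivative_eq_intros)

lemma M_expansion:
  "((\<lambda>s. (M s - 1 - e * \<tau> * s) / s\<^sup>2) \<longlongrightarrow> e * (e - 1) * \<tau>\<^sup>2 / 2) (at_right 0)"
proof -
  note ev = eventually_at_right_real[OF D(1)]
  have lim: "((\<lambda>s. (1 + \<tau> * s) powr a) \<longlongrightarrow> 1) (at_right 0)" for a
  proof -
    have "((\<lambda>s. (1 + \<tau> * s) powr a) \<longlongrightarrow> (1 + \<tau> * 0) powr a) (at_right 0)"
      by (intro tendsto_intros) auto
    then show ?thesis by simp
  qed
  have 1: "((\<lambda>s. (e * \<tau> * (1 + \<tau> * s) powr (e - 1) - e * \<tau>) / (2 * s)) \<longlongrightarrow> e * (e - 1) * \<tau>\<^sup>2 / 2)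
      (at_right 0)"
  proof (rule lhopital_right_0[where f' = "\<lambda>s. e * \<tau> * ((e - 1) * \<tau> * (1 + \<tau> * s) powr (e - 1 - 1))"
        and g' = "\<lambda>s. 2"])
    have "((\<lambda>s. e * \<tau> * (1 + \<tau> * s) powr (e - 1) - e * \<tau>) \<longlongrightarrow> e * \<tau> * 1 - e * \<tau>) (at_right 0)"
      by (intro tendsto_intros lim)
    then show "((\<lambda>s. e * \<tau> * (1 + \<tau> * s) powr (e - 1) - e * \<tau>) \<longlongrightarrow> 0) (at_right 0)" by simp
    show "((\<lambda>s::real. 2 * s) \<longlongrightarrow> 0) (at_right 0)" by real_asymp
    show "\<forall>\<^sub>F s in at_right 0. 2 * s \<noteq> (0::real)" using ev by eventually_elim simp
    show "\<forall>\<^sub>F s in at_right 0. ((\<lambda>s. e * \<tau> * (1 + \<tau> * s) powr (e - 1) - e * \<tau>) has_real_derivative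
        e * \<tau> * ((e - 1) * \<tau> * (1 + \<tau> * s) powr (e - 1 - 1))) (at s)"
      using ev
    proof eventually_elim
      case (elim s)
      then show ?case
        using DERIV_diff[OF DERIV_cmult[OF M_has_derivative[of s "e - 1"], of "e * \<tau>"] DERIV_const]
        by simp
    qed
    show "\<forall>\<^sub>F s in at_right 0. ((\<lambda>s::real. 2 * s) has_real_derivative 2) (at s)"
      by (auto intro!: always_eventually derivative_eq_intros)
    have "((\<lambda>s. e * \<tau> * ((e - 1) * \<tau> * (1 + \<tau> * s) powr (e - 1 - 1)) / 2) \<longlongrightarrow>
        e * \<tau> * ((e - 1) * \<tau> * 1) / 2) (at_right 0)"
      by (intro tendsto_intros lim) auto
    then show "((\<lambda>s. e * \<tau> * ((e - 1) * \<tau> * (1 + \<tau> * s) powr (e - 1 - 1)) / 2) \<longlongrightarrow>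
        e * (e - 1) * \<tau>\<^sup>2 / 2) (at_right 0)"
      by (simp add: power2_eq_square mult_ac)
  qed auto
  show ?thesis
  proof (rule lhopital_right_0[where f' = "\<lambda>s. e * \<tau> * (1 + \<tau> * s) powr (e - 1) - e * \<tau>"
        and g' = "\<lambda>s. 2 * s", OF _ _ _ _ _ _ 1])
    have "((\<lambda>s. M s - 1 - e * \<tau> * s) \<longlongrightarrow> 1 - 1 - e * \<tau> * 0) (at_right 0)"
      unfolding M_def by (intro tendsto_intros lim)
    then show "((\<lambda>s. M s - 1 - e * \<tau> * s) \<longlongrightarrow> 0) (at_right 0)" by simp
    show "((\<lambda>s::real. s\<^sup>2) \<longlongrightarrow> 0) (at_right 0)" by real_asymp
    show "\<forall>\<^sub>F s in at_right 0. s\<^sup>2 \<noteq> (0::real)" "\<forall>\<^sub>F s in at_right 0. 2 * s \<noteq> (0::real)"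
      using ev by (eventually_elim; simp)+
    show "\<forall>\<^sub>F s in at_right 0. ((\<lambda>s. M s - 1 - e * \<tau> * s) has_real_derivative
        e * \<tau> * (1 + \<tau> * s) powr (e - 1) - e * \<tau>) (at s)"
      using ev
    proof eventually_elim
      case (elim s)
      then have "((\<lambda>s. (1 + \<tau> * s) powr e) has_real_derivative e * \<tau> * (1 + \<tau> * s) powr (e - 1)) (at s)"
        by (intro M_has_derivative) auto
      then show ?case
        unfolding M_def
        using DERIV_diff[OF DERIV_diff[OF _ DERIV_const] DERIV_cmult[OF DERIV_ident, of "e * \<tau>"]]
        by fastforce
    qed
    show "\<forall>\<^sub>F s in at_right 0. ((\<lambda>s::real. s\<^sup>2) has_real_derivative 2 * s) (at s)"
      by (auto intro!: always_eventually derivative_eq_intros)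
  qed
qed

end

section \<open>Solutions of the second-order equation\<close>

text \<open>The derivatives are explicit arguments so that identities between solutions can be
  differentiated by uniqueness of derivatives. The coefficient \<open>b\<close> is that of the
  first-order term in the variable \<open>\<delta>\<close>.\<close>

definition boundary_solution ::
  "(real \<Rightarrow> real) \<Rightarrow> real \<Rightarrow> real \<Rightarrow> real \<Rightarrow> (real \<Rightarrow> real) \<Rightarrow> (real \<Rightarrow> real) \<Rightarrow> (real \<Rightarrow> real) \<Rightarrow> bool" where
  "boundary_solution b \<mu> p d w w' w'' \<longleftrightarrow>
     (\<forall>s\<in>{0<..<d}. 0 < w s \<and> (w has_real_derivative w' s) (at s) \<and>
        (w' has_real_derivative w'' s) (at s) \<and>
        w'' s + b s * w' s + \<mu> / s\<^sup>2 * w s = w s powr p)"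

context singular_ode
begin

text \<open>This is \<open>-2 * M' / M\<close>, the first-order coefficient that the factor
  \<open>M\<close> removes. With the values of \<open>e\<close> and \<open>\<tau>\<close> chosen
  later it equals \<open>\<sigma> * (real N - 1) / (\<rho> + \<sigma> * s)\<close>.\<close>

definition drift :: "real \<Rightarrow> real" where "drift s = - 2 * e * \<tau> / (1 + \<tau> * s)"

text \<open>The coefficients of \<open>z - v\<close> are proportional to \<open>v\<close>, so
  division by \<open>v\<close> leaves a constant free of \<open>v\<close> and \<open>c\<close>.
  Below \<open>-1/2\<close> the Taylor coefficient of \<open>M\<close> has the same order and is
  added.\<close>

definition eta_const :: real where
  "eta_const = (if \<beta> = -1/2 then q 0 / 2 else e * (e - 1) * \<tau>\<^sup>2 / 2 - q 0 / (2 * (2*\<beta> + 1)))"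

definition sol :: "(real \<Rightarrow> real) \<Rightarrow> real \<Rightarrow> real" where
  "sol z s = M s * s powr \<beta> * z s"

text \<open>Obtained by solving the claimed expansion for \<open>\<eta>\<close>; the
  \<open>C\<close>-term becomes \<open>s powr (1 - 2*\<beta>)\<close> after division by
  \<open>s powr \<beta>\<close>.\<close>

definition remainder :: "real \<Rightarrow> real \<Rightarrow> (real \<Rightarrow> real) \<Rightarrow> real \<Rightarrow> real" where
  "remainder v C z s = M s * z s / v - 1 - e * \<tau> * s - C / v * s powr (1 - 2*\<beta>)"

lemma M_tendsto: "(M \<longlongrightarrow> 1) (at_right 0)"
proof -
  have "(M \<longlongrightarrow> (1 + \<tau> * 0) powr e) (at_right 0)"
    unfolding M_def[abs_def] by (intro tendsto_intros) auto
  then show ?thesis by simp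
qed

text \<open>One statement for all three regimes, with \<open>X\<close> the scale. It rests on the
  splitting \<open>M z / v - 1 - e \<tau> s = (M - 1 - e \<tau> s) + M (z - v) / v\<close>.\<close>

lemma remainder_tendsto:
  assumes v: "0 < v"
    and sq: "((\<lambda>s. s\<^sup>2 / X s) \<longlongrightarrow> \<alpha>) (at_right 0)"
    and z: "((\<lambda>s. (z s - v) / X s) \<longlongrightarrow> \<gamma>) (at_right 0)"
    and pw: "((\<lambda>s. s powr (1 - 2*\<beta>) / X s) \<longlongrightarrow> \<kappa>) (at_right 0)"
  shows "((\<lambda>s. remainder v C z s / X s) \<longlongrightarrow>
    e * (e - 1) * \<tau>\<^sup>2 / 2 * \<alpha> + \<gamma> / v - C / v * \<kappa>) (at_right 0)"
proof -
  have "((\<lambda>s. (M s - 1 - e * \<tau> * s) / s\<^sup>2 * (s\<^sup>2 / X s) + M s * ((z s - v) / X s / v)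
      - C / v * (s powr (1 - 2*\<beta>) / X s)) \<longlongrightarrow>
    e * (e - 1) * \<tau>\<^sup>2 / 2 * \<alpha> + 1 * (\<gamma> / v) - C / v * \<kappa>) (at_right 0)"
    using v by (intro tendsto_intros M_expansion M_tendsto sq z pw) auto
  then show ?thesis
  proof (rule Lim_transform_eventually[THEN tendsto_eq_rhs])
    show "\<forall>\<^sub>F s in at_right 0. (M s - 1 - e * \<tau> * s) / s\<^sup>2 * (s\<^sup>2 / X s) + M s * ((z s - v) / X s / v)
      - C / v * (s powr (1 - 2*\<beta>) / X s) = remainder v C z s / X s"
      using eventually_at_right_real[OF D(1)]
    proof eventually_elim
      case (elim s)
      have "(M s - 1 - e * \<tau> * s) / s\<^sup>2 * (s\<^sup>2 / X s) = (M s - 1 - e * \<tau> * s) / X s"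
        using elim by simp
      moreover have "M s * ((z s - v) / X s / v) = (M s * z s / v - M s) / X s"
        using v by (cases "X s = 0") (simp_all add: field_simps)
      moreover have "C / v * (s powr (1 - 2*\<beta>) / X s) = (C / v * s powr (1 - 2*\<beta>)) / X s"
        by simp
      ultimately show ?case
        by (simp only: remainder_def add_divide_distrib[symmetric] diff_divide_distrib[symmetric]) simp
    qed
  qed simp
qed

text \<open>Above \<open>-1/2\<close> the factor \<open>1 - 2*\<beta>\<close> in the parameter makes
  the leading part of \<open>z - v\<close> cancel the explicit \<open>C\<close>-term, and
  \<open>s\<^sup>2\<close> is of smaller order. In the other regimes the \<open>C\<close>-term is
  itself small against the scale.\<close>

lemma remainder_asymptotics:
  assumes v: "0 < v" and d: "0 < d" "d \<le> D" and P: "profile v d ((1 - 2*\<beta>) * C) z B"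
  shows "eta_asymptotics \<beta> eta_const (remainder v C z)"
proof -
  have o: "(\<lambda>s. remainder v C z s - K * X s) \<in> o[at_right 0](X)"
    if "((\<lambda>s. remainder v C z s / X s) \<longlongrightarrow> K) (at_right 0)"
      "\<forall>\<^sub>F s in at_right 0. X s \<noteq> 0" for K X
  proof (rule smalloI_tendsto)
    have "((\<lambda>s. remainder v C z s / X s - K) \<longlongrightarrow> K - K) (at_right 0)"
      by (intro tendsto_intros that)
    then have "((\<lambda>s. remainder v C z s / X s - K) \<longlongrightarrow> 0) (at_right 0)" by simp
    then show "((\<lambda>s. (remainder v C z s - K * X s) / X s) \<longlongrightarrow> 0) (at_right 0)"
      by (rule Lim_transform_eventually)
        (use that(2) in \<open>eventually_elim, simp add: diff_divide_distrib\<close>)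
  qed (rule that)
  note ev = eventually_at_right_real[OF d(1)]
  show ?thesis
    unfolding eta_asymptotics_def
  proof (intro conjI impI)
    assume b: "-1/2 < \<beta>"
    have "((\<lambda>s. s\<^sup>2 / s powr (1 - 2*\<beta>)) \<longlongrightarrow> 0) (at_right 0)" using b by real_asymp
    moreover have "((\<lambda>s. s powr (1 - 2*\<beta>) / s powr (1 - 2*\<beta>)) \<longlongrightarrow> 1) (at_right 0)"
      by (rule tendsto_eventually) (use ev in \<open>eventually_elim, simp\<close>)
    ultimately have "((\<lambda>s. remainder v C z s / s powr (1 - 2*\<beta>)) \<longlongrightarrow>
        e * (e - 1) * \<tau>\<^sup>2 / 2 * 0 + (1 - 2*\<beta>) * C / (1 - 2*\<beta>) / v - C / v * 1) (at_right 0)"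
      by (intro remainder_tendsto v profile_asymptotics_gt[OF b d(1) P])
    then have "((\<lambda>s. remainder v C z s / s powr (1 - 2*\<beta>)) \<longlongrightarrow> 0) (at_right 0)"
      using beta_neg by simp
    moreover have "\<forall>\<^sub>F s in at_right 0. s powr (1 - 2*\<beta>) \<noteq> 0"
      using ev by eventually_elim auto
    ultimately show "remainder v C z \<in> o[at_right 0](\<lambda>s. s powr (1 - 2*\<beta>))"
      using o[of "\<lambda>s. s powr (1 - 2*\<beta>)" 0] by simp
  next
    assume b: "\<beta> = -1/2"
    have "((\<lambda>s::real. s\<^sup>2 / (s\<^sup>2 * \<bar>ln s\<bar>)) \<longlongrightarrow> 0) (at_right 0)" by real_asymp
    moreover have "((\<lambda>s. s powr (1 - 2*\<beta>) / (s\<^sup>2 * \<bar>ln s\<bar>)) \<longlongrightarrow> 0) (at_right 0)"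
      unfolding b by real_asymp
    ultimately have "((\<lambda>s. remainder v C z s / (s\<^sup>2 * \<bar>ln s\<bar>)) \<longlongrightarrow>
        e * (e - 1) * \<tau>\<^sup>2 / 2 * 0 + q 0 * v / 2 / v - C / v * 0) (at_right 0)"
      by (intro remainder_tendsto v profile_asymptotics_eq[OF b v d P])
    moreover have "e * (e - 1) * \<tau>\<^sup>2 / 2 * 0 + q 0 * v / 2 / v - C / v * 0 = eta_const"
      using b v unfolding eta_const_def by simp
    ultimately have "((\<lambda>s. remainder v C z s / (s\<^sup>2 * \<bar>ln s\<bar>)) \<longlongrightarrow> eta_const) (at_right 0)"
      by (simp only:)
    moreover have "\<forall>\<^sub>F s in at_right 0. s\<^sup>2 * \<bar>ln s\<bar> \<noteq> (0::real)"
      using eventually_at_right_real[OF zero_less_one] by eventually_elim auto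
    ultimately show "(\<lambda>s. remainder v C z s - eta_const * (s\<^sup>2 * \<bar>ln s\<bar>))
        \<in> o[at_right 0](\<lambda>s. s\<^sup>2 * \<bar>ln s\<bar>)"
      by (rule o)
  next
    assume b: "\<beta> < -1/2"
    have "((\<lambda>s::real. s\<^sup>2 / s\<^sup>2) \<longlongrightarrow> 1) (at_right 0)" by real_asymp
    moreover have "((\<lambda>s. s powr (1 - 2*\<beta>) / s\<^sup>2) \<longlongrightarrow> 0) (at_right 0)"
      using b by real_asymp
    ultimately have "((\<lambda>s. remainder v C z s / s\<^sup>2) \<longlongrightarrow>
        e * (e - 1) * \<tau>\<^sup>2 / 2 * 1 + - q 0 * v / (2 * (2*\<beta> + 1)) / v - C / v * 0) (at_right 0)"
      by (intro remainder_tendsto v profile_asymptotics_less[OF b v d P])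
    then have "((\<lambda>s. remainder v C z s / s\<^sup>2) \<longlongrightarrow> eta_const) (at_right 0)"
      using v b by (simp add: eta_const_def)
    moreover have "\<forall>\<^sub>F s in at_right 0. s\<^sup>2 \<noteq> (0::real)"
      using ev by eventually_elim auto
    ultimately show "(\<lambda>s. remainder v C z s - eta_const * s\<^sup>2) \<in> o[at_right 0](\<lambda>s. s\<^sup>2)"
      by (rule o)
  qed
qed

lemma sol_expansion:
  assumes "0 < v" "0 < s"
  shows "sol z s = s powr \<beta> * v * (1 + e * \<tau> * s + remainder v C z s) + C * s powr (1 - \<beta>)"
proof -
  have "s powr (1 - \<beta>) = s powr \<beta> * s powr (1 - 2*\<beta>)"
    by (simp add: powr_add[symmetric])
  with assms show ?thesis
    by (simp add: sol_def remainder_def field_simps)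
qed

lemma sol_tendsto:
  assumes "0 < d" "profile v d c z B"
  shows "((\<lambda>s. sol z s / s powr \<beta>) \<longlongrightarrow> v) (at_right 0)"
proof -
  have "((\<lambda>s. M s * z s) \<longlongrightarrow> 1 * v) (at_right 0)"
    by (intro tendsto_intros M_tendsto profile_tendsto[OF assms])
  then have "((\<lambda>s. M s * z s) \<longlongrightarrow> v) (at_right 0)" by simp
  then show ?thesis
    by (rule Lim_transform_eventually)
      (use eventually_at_right_real[OF assms(1)] in \<open>eventually_elim, simp add: sol_def\<close>)
qed

text \<open>The interval is shortened until \<open>z > v / 2\<close>, where the truncation in
  \<open>G\<close> is inactive; reversing the Liouville substitution then gives the original
  equation.\<close>

lemma sol_boundary_solution:
  assumes v: "0 < v" and d: "0 < d" "d \<le> D" and P: "profile v d c z B"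
  obtains d' w' w'' where "0 < d'" "d' \<le> d"
    "boundary_solution drift (\<beta> - \<beta>\<^sup>2) p d' (sol z) w' w''"
proof -
  have "\<forall>\<^sub>F s in at_right 0. v / 2 < z s"
    by (rule order_tendstoD(1)[OF profile_tendsto[OF d(1) P]]) (use v in simp)
  then obtain b where b: "0 < b" "\<And>s. 0 < s \<Longrightarrow> s < b \<Longrightarrow> v / 2 < z s"
    by (auto simp: eventually_at_right_field)
  define y where "y s = s powr \<beta> * z s" for s
  define Y where "Y s = s powr (-\<beta>) * B s" for s
  define y1 where "y1 s = \<beta> * y s / s + Y s" for s
  \<comment> \<open>On differentiating \<open>y1 = \<beta> y / s + Y\<close>, the terms in
    \<open>Y / s\<close> cancel, leaving the Euler term and the right-hand side.\<close>
  define y2 where "y2 s = (\<beta>\<^sup>2 - \<beta>) * y s / s\<^sup>2 + s powr \<beta> * G v s (z s)" for s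
  define M1 where "M1 s = e * \<tau> * M s / (1 + \<tau> * s)" for s
  define M2 where "M2 s = e * \<tau> * (M1 s / (1 + \<tau> * s) - M s * \<tau> / (1 + \<tau> * s)\<^sup>2)" for s
  have "boundary_solution drift (\<beta> - \<beta>\<^sup>2) p (min b d) (sol z)
      (\<lambda>s. M1 s * y s + M s * y1 s) (\<lambda>s. M2 s * y s + 2 * M1 s * y1 s + M s * y2 s)"
    unfolding boundary_solution_def
  proof (intro ballI conjI)
    fix s assume s: "s \<in> {0<..<min b d}"
    then have sd: "s \<in> {0<..<d}" and sD: "s \<in> {0..D}" and s0: "0 < s" using d by auto
    have zs: "v / 2 < z s" using b s by auto
    have ys: "0 < y s" using zs v s0 by (simp add: y_def)
    have r: "0 < 1 + \<tau> * s" using base_pos sD by blast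
    have Ms: "0 < M s" using M_pos sD by blast
    have sol_eq: "sol z t = M t * y t" for t by (simp add: sol_def y_def)
    show "0 < sol z s" using Ms ys by (simp add: sol_eq)
    have dM: "(M has_real_derivative M1 s) (at s)"
      using M_has_derivative[OF sD, of e] r
      unfolding M_def[abs_def] M1_def by (simp add: powr_diff)
    have dM1: "(M1 has_real_derivative M2 s) (at s)"
    proof -
      have "((\<lambda>t. 1 + \<tau> * t) has_real_derivative \<tau>) (at s)"
        by (auto intro!: derivative_eq_intros)
      from DERIV_cmult[OF DERIV_divide[OF dM this], of "e * \<tau>"]
      have 1: "((\<lambda>t. e * \<tau> * (M t / (1 + \<tau> * t))) has_real_derivative
          e * \<tau> * ((M1 s * (1 + \<tau> * s) - M s * \<tau>) / ((1 + \<tau> * s) * (1 + \<tau> * s)))) (at s)"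
        using r by simp
      have 2: "e * \<tau> * ((M1 s * (1 + \<tau> * s) - M s * \<tau>) / ((1 + \<tau> * s) * (1 + \<tau> * s))) = M2 s"
        unfolding M2_def using r by (simp add: diff_divide_distrib power2_eq_square)
      have 3: "(\<lambda>t. e * \<tau> * (M t / (1 + \<tau> * t))) = M1"
        by (simp add: M1_def fun_eq_iff)
      show ?thesis using 1 unfolding 2 3 .
    qed
    have dy: "(y has_real_derivative y1 s) (at s)"
    proof -
      have "(y has_real_derivative \<beta> * s powr (\<beta> - 1) * z s + s powr (-2*\<beta>) * B s * s powr \<beta>) (at s)"
        unfolding y_def[abs_def]
        by (intro DERIV_mult profileD(3)[OF P sd] has_real_derivative_powr s0)
      moreover have "s powr (-2*\<beta>) * s powr \<beta> = s powr (-\<beta>)"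
        by (simp add: powr_add[symmetric])
      ultimately show ?thesis
        using s0 by (simp add: y1_def y_def Y_def powr_diff mult_ac)
    qed
    have dY: "(Y has_real_derivative - \<beta> * Y s / s + s powr \<beta> * G v s (z s)) (at s)"
    proof -
      have "(Y has_real_derivative
          - \<beta> * s powr (-\<beta> - 1) * B s + s powr (2*\<beta>) * G v s (z s) * s powr (-\<beta>)) (at s)"
        unfolding Y_def[abs_def]
        by (intro DERIV_mult profileD(4)[OF P sd] has_real_derivative_powr s0)
      moreover have "s powr (2*\<beta>) * G v s (z s) * s powr (-\<beta>) = s powr \<beta> * G v s (z s)"
        by (simp add: powr_add[symmetric])
      moreover have "- \<beta> * s powr (-\<beta> - 1) * B s = - \<beta> * Y s / s"
        using s0 by (simp add: Y_def powr_diff)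
      ultimately show ?thesis by (simp only:)
    qed
    have dy1: "(y1 has_real_derivative y2 s) (at s)"
      unfolding y1_def[abs_def] using s0
      by (auto intro!: derivative_eq_intros dy dY simp: y1_def y2_def field_simps power2_eq_square)
    show "(sol z has_real_derivative M1 s * y s + M s * y1 s) (at s)"
      unfolding sol_eq[abs_def] by (auto intro!: derivative_eq_intros dM dy)
    show "((\<lambda>s. M1 s * y s + M s * y1 s) has_real_derivative
        M2 s * y s + 2 * M1 s * y1 s + M s * y2 s) (at s)"
      by (auto intro!: derivative_eq_intros dM dM1 dy dy1)
    \<comment> \<open>The exponents are arranged so that
      \<open>\<beta> + (p - 1) * \<beta> = p * \<beta>\<close>, and likewise for the powers of
      \<open>M\<close>.\<close>
    have nonlin: "s powr \<beta> * (M s powr (p - 1) * s powr ((p - 1) * \<beta>) * max (z s) (v/2) powr p)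
        = (M s * y s) powr p / M s"
    proof -
      have "s powr \<beta> * s powr ((p - 1) * \<beta>) = (s powr \<beta>) powr p"
        by (simp add: powr_add[symmetric] powr_powr algebra_simps)
      then show ?thesis
        using zs v Ms s0 by (simp add: y_def powr_mult powr_diff mult_ac max_def)
    qed
    have Gs: "s powr \<beta> * G v s (z s) = - q s * y s + (M s * y s) powr p / M s"
    proof -
      have "s powr \<beta> * G v s (z s) = - q s * (s powr \<beta> * z s) +
          s powr \<beta> * (M s powr (p - 1) * s powr ((p - 1) * \<beta>) * max (z s) (v/2) powr p)"
        by (simp add: G_def algebra_simps)
      then show ?thesis unfolding nonlin by (simp only: y_def)
    qed
    \<comment> \<open>All linear terms cancel identically: \<open>drift = -2 * M' / M\<close>
      removes \<open>y1\<close>, the choice of \<open>q\<close> removes the zeroth-order terms from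
      \<open>M\<close>, and the Euler terms are opposite.\<close>
    have lin: "M2 s * y s + 2 * M1 s * y1 s + M s * ((\<beta>\<^sup>2 - \<beta>) * y s / s\<^sup>2 - q s * y s)
        + drift s * (M1 s * y s + M s * y1 s) + (\<beta> - \<beta>\<^sup>2) / s\<^sup>2 * (M s * y s) = 0"
      unfolding M2_def M1_def drift_def q_def using r s0
      by (simp add: divide_simps) (simp add: algebra_simps power2_eq_square)
    have "M s * y2 s = M s * ((\<beta>\<^sup>2 - \<beta>) * y s / s\<^sup>2 - q s * y s) + (M s * y s) powr p"
      using Ms unfolding y2_def Gs by (simp add: field_simps)
    with lin show "M2 s * y s + 2 * M1 s * y1 s + M s * y2 s +
        drift s * (M1 s * y s + M s * y1 s) + (\<beta> - \<beta>\<^sup>2) / s\<^sup>2 * sol z s = sol z s powr p"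
      unfolding sol_eq by linarith
  qed
  then show ?thesis using b d by (intro that) auto
qed

end

section \<open>Dependence of the remainder on the parameters\<close>

text \<open>The power \<open>s powr (1 - \<beta>)\<close> is annihilated by the Euler part of the operator, so only its
  image under the first-order term survives.\<close>

lemma boundary_solution_combination:
  assumes w: "boundary_solution b (\<beta> - \<beta>\<^sup>2) p d1 w w' w''" "0 < d1"
    and x: "boundary_solution b (\<beta> - \<beta>\<^sup>2) p d2 x x' x''" "0 < d2"
    and ev: "\<forall>\<^sub>F s in at_right 0. k * w s + l * x s = m * s powr (1 - \<beta>)"
  shows "\<forall>\<^sub>F s in at_right 0. k * w s powr p + l * x s powr p = m * (1 - \<beta>) * b s * s powr (-\<beta>)"
proof -
  obtain a where a: "0 < a" "\<And>s. 0 < s \<Longrightarrow> s < a \<Longrightarrow> k * w s + l * x s = m * s powr (1 - \<beta>)"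
    using ev by (auto simp: eventually_at_right_field)
  define d where "d = min a (min d1 d2)"
  have d: "0 < d" using a w x by (simp add: d_def)
  have eq: "k * w s + l * x s = m * s powr (1 - \<beta>)" if "s \<in> {0<..<d}" for s
    using that a by (auto simp: d_def)
  have W: "(w has_real_derivative w' s) (at s)" "(w' has_real_derivative w'' s) (at s)"
      "w'' s + b s * w' s + (\<beta> - \<beta>\<^sup>2) / s\<^sup>2 * w s = w s powr p"
    and X: "(x has_real_derivative x' s) (at s)" "(x' has_real_derivative x'' s) (at s)"
      "x'' s + b s * x' s + (\<beta> - \<beta>\<^sup>2) / s\<^sup>2 * x s = x s powr p" if "s \<in> {0<..<d}" for s
    using that w x by (auto simp: boundary_solution_def d_def)
  \<comment> \<open>Equality on an open interval forces equality of the derivatives there; the same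
    argument gives the second derivatives.\<close>
  have eq1: "k * w' s + l * x' s = m * (1 - \<beta>) * s powr (-\<beta>)" if s: "s \<in> {0<..<d}" for s
  proof (rule DERIV_unique)
    show "((\<lambda>s. k * w s + l * x s) has_real_derivative k * w' s + l * x' s) (at s)"
      by (intro DERIV_add DERIV_cmult W X s)
    have "((\<lambda>s. m * s powr (1 - \<beta>)) has_real_derivative m * (1 - \<beta>) * s powr (-\<beta>)) (at s)"
      using s by (auto intro!: derivative_eq_intros)
    then show "((\<lambda>s. k * w s + l * x s) has_real_derivative m * (1 - \<beta>) * s powr (-\<beta>)) (at s)"
      by (rule has_field_derivative_transform_within_open[where S = "{0<..<d}"])
        (use s eq in auto)
  qed
  have eq2: "k * w'' s + l * x'' s = m * (1 - \<beta>) * (- \<beta>) * s powr (-\<beta> - 1)" if s: "s \<in> {0<..<d}" for s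
  proof (rule DERIV_unique)
    show "((\<lambda>s. k * w' s + l * x' s) has_real_derivative k * w'' s + l * x'' s) (at s)"
      by (intro DERIV_add DERIV_cmult W X s)
    have "((\<lambda>s. m * (1 - \<beta>) * s powr (-\<beta>)) has_real_derivative
        m * (1 - \<beta>) * (- \<beta> * s powr (-\<beta> - 1))) (at s)"
      using s by (intro DERIV_cmult has_real_derivative_powr) auto
    then have "((\<lambda>s. m * (1 - \<beta>) * s powr (-\<beta>)) has_real_derivative
        m * (1 - \<beta>) * (- \<beta>) * s powr (-\<beta> - 1)) (at s)"
      by (simp only: mult.assoc)
    then show "((\<lambda>s. k * w' s + l * x' s) has_real_derivative
        m * (1 - \<beta>) * (- \<beta>) * s powr (-\<beta> - 1)) (at s)"
      by (rule has_field_derivative_transform_within_open[where S = "{0<..<d}"])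
        (use s eq1 in auto)
  qed
  have "k * w s powr p + l * x s powr p = m * (1 - \<beta>) * b s * s powr (-\<beta>)"
    if s: "s \<in> {0<..<d}" for s
  proof -
    have "k * w s powr p + l * x s powr p =
        (k * w'' s + l * x'' s) + b s * (k * w' s + l * x' s) + (\<beta> - \<beta>\<^sup>2) / s\<^sup>2 * (k * w s + l * x s)"
      unfolding W(3)[OF s, symmetric] X(3)[OF s, symmetric]
      by (simp add: algebra_simps add_divide_distrib diff_divide_distrib)
    also have "\<dots> = m * (1 - \<beta>) * (- \<beta>) * s powr (-\<beta> - 1) + b s * (m * (1 - \<beta>) * s powr (-\<beta>))
        + (\<beta> - \<beta>\<^sup>2) / s\<^sup>2 * (m * s powr (1 - \<beta>))"
      unfolding eq1[OF s] eq2[OF s] eq[OF s] ..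
    also have "s powr (1 - \<beta>) = s powr (-\<beta> - 1) * s\<^sup>2"
      using s by (simp add: powr_add[symmetric] flip: powr_numeral)
    also have "m * (1 - \<beta>) * (- \<beta>) * s powr (-\<beta> - 1) + b s * (m * (1 - \<beta>) * s powr (-\<beta>))
        + (\<beta> - \<beta>\<^sup>2) / s\<^sup>2 * (m * (s powr (-\<beta> - 1) * s\<^sup>2)) = m * (1 - \<beta>) * b s * s powr (-\<beta>)"
    proof -
      have "(\<beta> - \<beta>\<^sup>2) / s\<^sup>2 * (m * (s powr (-\<beta> - 1) * s\<^sup>2)) = (\<beta> - \<beta>\<^sup>2) * m * s powr (-\<beta> - 1)"
        using s by simp
      then show ?thesis by (simp only:) (simp add: algebra_simps power2_eq_square)
    qed
    finally show ?thesis .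
  qed
  with eventually_at_right_real[OF d] show ?thesis by (rule eventually_mono)
qed

context singular_ode
begin

lemma drift_tendsto: "(drift \<longlongrightarrow> - 2 * e * \<tau>) (at_right 0)"
proof -
  have "(drift \<longlongrightarrow> - 2 * e * \<tau> / (1 + \<tau> * 0)) (at_right 0)"
    unfolding drift_def[abs_def] by (intro tendsto_intros) auto
  then show ?thesis by simp
qed

lemma sol_filterlim_at_top:
  assumes "0 < v" "0 < d" "profile v d c z B"
  shows "filterlim (sol z) at_top (at_right 0)"
proof -
  have "LIM s at_right 0. s powr \<beta> :> at_top" using beta_neg by real_asymp
  then have "LIM s at_right 0. sol z s / s powr \<beta> * s powr \<beta> :> at_top"
    by (rule filterlim_tendsto_pos_mult_at_top[OF sol_tendsto[OF assms(2,3)] assms(1)])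
  moreover have "\<forall>\<^sub>F s in at_right 0. sol z s / s powr \<beta> * s powr \<beta> = sol z s"
    using eventually_at_right_real[OF assms(2)] by eventually_elim simp
  ultimately show ?thesis using filterlim_cong by fastforce
qed

text \<open>Otherwise the drift would be positive but, by concavity of \<open>t powr p\<close> and because the
  solutions blow up, of order \<open>s\<close>, whereas it is of constant sign with limit \<open>- 2 * e * \<tau>\<close>.\<close>

lemma sol_diff_not_power:
  assumes v: "0 < v" and d: "0 < d" "d \<le> D"
    and P: "profile v d c z B" and P': "profile v d c' z' B'" and k: "0 < k"
  shows "\<not> (\<forall>\<^sub>F s in at_right 0. sol z s - sol z' s = k * s powr (1 - \<beta>))"
proof
  assume ev: "\<forall>\<^sub>F s in at_right 0. sol z s - sol z' s = k * s powr (1 - \<beta>)"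
  obtain d1 w' w'' where S: "0 < d1" "boundary_solution drift (\<beta> - \<beta>\<^sup>2) p d1 (sol z) w' w''"
    using sol_boundary_solution[OF v d P] by blast
  obtain d2 x' x'' where S': "0 < d2" "boundary_solution drift (\<beta> - \<beta>\<^sup>2) p d2 (sol z') x' x''"
    using sol_boundary_solution[OF v d P'] by blast
  have "\<forall>\<^sub>F s in at_right 0. 1 * sol z s + (-1) * sol z' s = k * s powr (1 - \<beta>)"
    using ev by simp
  from boundary_solution_combination[OF S(2,1) S'(2,1) this]
  have diff: "\<forall>\<^sub>F s in at_right 0. sol z s powr p - sol z' s powr p = k * (1 - \<beta>) * drift s * s powr (-\<beta>)"
    by simp
  have large: "\<forall>\<^sub>F s in at_right 0. 1 \<le> sol z' s"
    using sol_filterlim_at_top[OF v d(1) P'] by (simp add: filterlim_at_top)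
  have pos: "\<forall>\<^sub>F s in at_right 0. 0 < drift s \<and> drift s \<le> p / (1 - \<beta>) * s"
    using ev diff large eventually_at_right_real[OF d(1)]
  proof eventually_elim
    case (elim s)
    have s: "0 < s" using elim by simp
    have ks: "0 < k * s powr (1 - \<beta>)" using k s by simp
    then have less: "sol z' s < sol z s" using elim by linarith
    then have "0 < sol z s powr p - sol z' s powr p"
      using powr_less_mono2[of p "sol z' s" "sol z s"] p elim(3) by simp
    then have "0 < k * (1 - \<beta>) * drift s * s powr (-\<beta>)" using elim by simp
    then have "0 < (k * (1 - \<beta>) * s powr (-\<beta>)) * drift s" by (simp add: mult_ac)
    then have "0 < drift s"
      by (rule zero_less_mult_pos) (use k beta_neg s in simp)
    have "\<bar>sol z s powr p - sol z' s powr p\<bar> \<le> p * sol z' s powr (p - 1) * \<bar>sol z s - sol z' s\<bar>"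
      using p elim less by (intro powr_lipschitz_above) auto
    \<comment> \<open>The solution is at least 1 near the boundary and
      \<open>p - 1 < 0\<close>.\<close>
    also have "\<dots> \<le> p * 1 * \<bar>sol z s - sol z' s\<bar>"
    proof (intro mult_right_mono mult_left_mono)
      have "sol z' s powr (p - 1) \<le> sol z' s powr 0" using p elim by (intro powr_mono) auto
      then show "sol z' s powr (p - 1) \<le> 1" using elim by simp
    qed (use p in auto)
    finally have "k * (1 - \<beta>) * drift s * s powr (-\<beta>) \<le> p * (k * s powr (1 - \<beta>))"
      using elim ks by simp
    also have "s powr (1 - \<beta>) = s * s powr (-\<beta>)"
      using s by (simp add: powr_mult_base)
    finally have "(k * s powr (-\<beta>)) * ((1 - \<beta>) * drift s) \<le> (k * s powr (-\<beta>)) * (p * s)"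
      by (simp add: mult_ac)
    then have "(1 - \<beta>) * drift s \<le> p * s"
      by (rule mult_left_le_imp_le) (use k s in simp)
    then have "drift s \<le> p / (1 - \<beta>) * s"
      using beta_neg by (simp add: field_simps)
    with \<open>0 < drift s\<close> show ?case by simp
  qed
  have "- 2 * e * \<tau> \<le> 0"
  proof (rule tendsto_le[OF _ _ drift_tendsto])
    show "((\<lambda>s. p / (1 - \<beta>) * s) \<longlongrightarrow> 0) (at_right 0)"
      by (intro tendsto_eq_intros) auto
    show "\<forall>\<^sub>F s in at_right 0. drift s \<le> p / (1 - \<beta>) * s" using pos by eventually_elim simp
  qed simp
  \<comment> \<open>Multiplying the drift by \<open>1 + \<tau> * s\<close> gives a constant, so
    positivity at one point is positivity of the limit. A vanishing drift is excluded as
    well.\<close>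
  moreover have "\<forall>\<^sub>F s::real in at_right 0. 0 < - 2 * e * \<tau>"
    using pos eventually_at_right_real[OF D(1)]
  proof eventually_elim
    case (elim s)
    then have "0 < 1 + \<tau> * s" using base_pos[of s] by simp
    moreover from this have "drift s * (1 + \<tau> * s) = - 2 * e * \<tau>" by (simp add: drift_def)
    ultimately show ?case using elim mult_pos_pos[of "drift s" "1 + \<tau> * s"] by simp
  qed
  ultimately show False by simp
qed

text \<open>The factor 2 cancels the leading terms for \<open>v = 1\<close> and
  \<open>v = 2\<close>, but not those of the \<open>p\<close>-th powers, because
  \<open>2 powr p < 2\<close>. These have order \<open>s powr (p * \<beta>)\<close>, whereas the
  other side would be \<open>O(s powr (-\<beta>))\<close>, which is smaller.\<close>

lemma sol_scaled_diff_not_power: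
  assumes d: "0 < d" "d \<le> D" "0 < d'" "d' \<le> D"
    and P: "profile 1 d c z B" and P': "profile 2 d' c' z' B'"
  shows "\<not> (\<forall>\<^sub>F s in at_right 0. 2 * sol z s - sol z' s = k * s powr (1 - \<beta>))"
proof
  assume ev: "\<forall>\<^sub>F s in at_right 0. 2 * sol z s - sol z' s = k * s powr (1 - \<beta>)"
  obtain d1 w' w'' where S: "0 < d1" "boundary_solution drift (\<beta> - \<beta>\<^sup>2) p d1 (sol z) w' w''"
    using sol_boundary_solution[OF zero_less_one d(1,2) P] by blast
  obtain d2 x' x'' where S': "0 < d2" "boundary_solution drift (\<beta> - \<beta>\<^sup>2) p d2 (sol z') x' x''"
    using sol_boundary_solution[OF zero_less_numeral d(3,4) P'] by blast
  have "\<forall>\<^sub>F s in at_right 0. 2 * sol z s + (-1) * sol z' s = k * s powr (1 - \<beta>)"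
    using ev by simp
  from boundary_solution_combination[OF S(2,1) S'(2,1) this]
  have diff: "\<forall>\<^sub>F s in at_right 0.
      2 * sol z s powr p - sol z' s powr p = k * (1 - \<beta>) * drift s * s powr (-\<beta>)"
    by simp
  have "((\<lambda>s. 2 * (sol z s / s powr \<beta>) powr p - (sol z' s / s powr \<beta>) powr p) \<longlongrightarrow>
      2 * 1 powr p - 2 powr p) (at_right 0)"
    by (intro tendsto_intros sol_tendsto[OF d(1) P] sol_tendsto[OF d(3) P']) auto
  moreover have "((\<lambda>s. 2 * (sol z s / s powr \<beta>) powr p - (sol z' s / s powr \<beta>) powr p) \<longlongrightarrow> 0) (at_right 0)"
  proof -
    have "((\<lambda>s. s powr (-\<beta> - p * \<beta>)) \<longlongrightarrow> 0) (at_right 0)"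
    proof -
      have "0 < -\<beta> - p * \<beta>" using p beta_neg mult_pos_neg[of p \<beta>] by linarith
      then show ?thesis by real_asymp
    qed
    then have "((\<lambda>s. k * (1 - \<beta>) * drift s * s powr (-\<beta> - p * \<beta>)) \<longlongrightarrow>
        k * (1 - \<beta>) * (- 2 * e * \<tau>) * 0) (at_right 0)"
      by (intro tendsto_intros drift_tendsto)
    then show ?thesis
    proof (rule Lim_transform_eventually[THEN tendsto_eq_rhs])
      show "\<forall>\<^sub>F s in at_right 0. k * (1 - \<beta>) * drift s * s powr (-\<beta> - p * \<beta>) =
          2 * (sol z s / s powr \<beta>) powr p - (sol z' s / s powr \<beta>) powr p"
        using diff eventually_at_right_real[OF S(1)] eventually_at_right_real[OF S'(1)]
      proof eventually_elim
        case (elim s)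
        have "0 < sol z s" "0 < sol z' s"
          using S S' elim by (auto simp: boundary_solution_def)
        then have "2 * (sol z s / s powr \<beta>) powr p - (sol z' s / s powr \<beta>) powr p =
            (2 * sol z s powr p - sol z' s powr p) / s powr (p * \<beta>)"
          by (simp add: powr_divide powr_powr diff_divide_distrib mult.commute)
        also have "\<dots> = k * (1 - \<beta>) * drift s * (s powr (-\<beta>) / s powr (p * \<beta>))"
          using elim by simp
        also have "s powr (-\<beta>) / s powr (p * \<beta>) = s powr (-\<beta> - p * \<beta>)"
          by (simp add: powr_diff)
        finally show ?case by simp
      qed
    qed simp
  qed
  ultimately have "2 * 1 powr p - 2 powr p = (0::real)"
    using tendsto_unique[OF trivial_limit_at_right_real] by blast
  moreover have "2 powr p < 2 powr (1::real)" using p by (intro powr_less_mono) auto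
  ultimately show False by simp
qed

end

section \<open>Return to the radial variable\<close>

text \<open>As \<open>\<sigma> * \<sigma> = 1\<close>, the inverse change of variable is
  \<open>s = \<sigma> * (r - \<rho>)\<close>. The second derivative is unchanged and the sign of the
  first is absorbed into the drift.\<close>

lemma boundary_solution_imp_radial_solution:
  fixes \<sigma> \<rho> :: real
  assumes w: "boundary_solution (\<lambda>s. \<sigma> * (real N - 1) / (\<rho> + \<sigma> * s)) \<mu> p d w w' w''"
    and \<sigma>: "\<sigma> * \<sigma> = 1"
    and dist: "\<And>s. s \<in> {0<..<d} \<Longrightarrow> bdist r0 R (\<rho> + \<sigma> * s) = s"
  shows "radial_solution_on N p \<mu> r0 R ((\<lambda>s. \<rho> + \<sigma> * s) ` {0<..<d}) (\<lambda>r. w (\<sigma> * (r - \<rho>)))"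
  unfolding radial_solution_on_def
proof safe
  fix s assume s: "s \<in> {0<..<d}"
  let ?u = "\<lambda>r. w (\<sigma> * (r - \<rho>))" and ?u' = "\<lambda>r. \<sigma> * w' (\<sigma> * (r - \<rho>))"
  have inv: "\<sigma> * (\<rho> + \<sigma> * t - \<rho>) = t" for t using \<sigma> by (simp add: mult.assoc[symmetric])
  have S: "0 < w t" "(w has_real_derivative w' t) (at t)" "(w' has_real_derivative w'' t) (at t)"
    "w'' t + \<sigma> * (real N - 1) / (\<rho> + \<sigma> * t) * w' t + \<mu> / t\<^sup>2 * w t = w t powr p"
    if "t \<in> {0<..<d}" for t
    using w that by (auto simp: boundary_solution_def)
  have sub: "((\<lambda>r. f (\<sigma> * (r - \<rho>))) has_real_derivative \<sigma> * f') (at r)"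
    if "(f has_real_derivative f') (at (\<sigma> * (r - \<rho>)))" for f f' r
  proof -
    have "((\<lambda>r. \<sigma> * (r - \<rho>)) has_real_derivative \<sigma>) (at r)"
      by (auto intro!: derivative_eq_intros)
    from DERIV_chain2[where g = "\<lambda>r. \<sigma> * (r - \<rho>)", OF that this]
    show ?thesis by (simp add: mult.commute)
  qed
  \<comment> \<open>The formula for \<open>deriv ?u\<close> is needed on a whole neighbourhood
    before it can be differentiated again.\<close>
  define U where "U = (\<lambda>r. \<sigma> * (r - \<rho>)) -` {0<..<d}"
  have U: "open U"
    unfolding U_def by (intro open_vimage continuous_intros open_greaterThanLessThan)
  have du: "(?u has_real_derivative ?u' r) (at r)" if "r \<in> U" for r
    using that sub[OF S(2), of r] by (simp add: U_def)
  have rU: "\<rho> + \<sigma> * s \<in> U" using s by (simp only: U_def vimage_eq inv)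
  have deriv: "deriv ?u r = ?u' r" if "r \<in> U" for r
    using du[OF that] by (rule DERIV_imp_deriv)
  have "(?u' has_real_derivative \<sigma> * (\<sigma> * w'' s)) (at (\<rho> + \<sigma> * s))"
    by (intro DERIV_cmult sub) (simp only: inv S(3)[OF s])
  moreover have "\<sigma> * (\<sigma> * w'' s) = w'' s" using \<sigma> by (simp add: mult.assoc[symmetric])
  ultimately have "(?u' has_real_derivative w'' s) (at (\<rho> + \<sigma> * s))" by (simp only:)
  then have ddu: "(deriv ?u has_real_derivative w'' s) (at (\<rho> + \<sigma> * s))"
    by (rule has_field_derivative_transform_within_open[OF _ U rU]) (rule deriv[symmetric])
  have u: "?u (\<rho> + \<sigma> * s) = w s" "deriv ?u (\<rho> + \<sigma> * s) = \<sigma> * w' s"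
      "deriv (deriv ?u) (\<rho> + \<sigma> * s) = w'' s"
    by (simp_all only: deriv[OF rU] inv DERIV_imp_deriv[OF ddu])
  show "0 \<le> ?u (\<rho> + \<sigma> * s)" using S(1)[OF s] unfolding u(1) by (rule less_imp_le)
  show "?u differentiable at (\<rho> + \<sigma> * s)"
    using du[OF rU] unfolding real_differentiable_def by blast
  show "deriv ?u differentiable at (\<rho> + \<sigma> * s)"
    using ddu unfolding real_differentiable_def by blast
  have "(real N - 1) / (\<rho> + \<sigma> * s) * (\<sigma> * w' s) = \<sigma> * (real N - 1) / (\<rho> + \<sigma> * s) * w' s"
    by simp
  then show "deriv (deriv ?u) (\<rho> + \<sigma> * s) + (real N - 1) / (\<rho> + \<sigma> * s) * deriv ?u (\<rho> + \<sigma> * s)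
      + \<mu> / (bdist r0 R (\<rho> + \<sigma> * s))\<^sup>2 * ?u (\<rho> + \<sigma> * s) = ?u (\<rho> + \<sigma> * s) powr p"
    unfolding u dist[OF s] by (simp only: S(4)[OF s])
qed

text \<open>\<open>beta_minus \<mu>\<close> is a root of \<open>x\<^sup>2 - x + \<mu>\<close>. As
  \<open>sqrt\<close> is odd on the reals, the hypothesis forces a positive radicand, which
  justifies squaring.\<close>

lemma beta_minus_eq:
  assumes "beta_minus \<mu> < 0"
  shows "beta_minus \<mu> - (beta_minus \<mu>)\<^sup>2 = \<mu>"
proof -
  have "1/2 < sqrt (1/4 - \<mu>)"
    using assms unfolding beta_minus_def by (rule diff_less_0_iff_less[THEN iffD1])
  then have "0 < sqrt (1/4 - \<mu>)" by (rule less_trans[rotated]) simp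
  then have "0 \<le> 1/4 - \<mu>" by (simp only: real_sqrt_gt_0_iff less_imp_le)
  then have "(sqrt (1/4 - \<mu>))\<^sup>2 = 1/4 - \<mu>" by (rule real_sqrt_pow2)
  then show ?thesis unfolding beta_minus_def power2_diff by (simp add: power2_eq_square)
qed
lemma beta_plus_eq: "beta_plus \<mu> = 1 - beta_minus \<mu>"
  by (simp add: beta_plus_def beta_minus_def)

text \<open>Both boundary components are treated at once, \<open>\<sigma>\<close> being the
  direction into the annulus. The constant \<open>K\<close> is \<open>eta_const\<close>, built from
  \<open>\<beta>\<close>, \<open>e\<close> and \<open>\<tau>\<close> alone.\<close>

lemma local_solution_family_exists:
  fixes N :: nat and p \<mu> r0 R \<rho> \<sigma> :: real
  assumes p: "0 < p" "p < 1" and r: "0 < r0" "r0 < R" and beta: "beta_minus \<mu> < 0"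
    and side: "\<rho> = R \<and> \<sigma> = -1 \<or> \<rho> = r0 \<and> \<sigma> = 1"
  shows "\<exists>K u \<eta>. local_solution_family N p \<mu> r0 R (\<lambda>s. \<rho> + \<sigma> * s)
    (- \<sigma> * (real N - 1) / (2 * \<rho>)) K u \<eta>"
proof -
  define \<beta> where "\<beta> = beta_minus \<mu>"
  \<comment> \<open>Half the width of the annulus keeps \<open>\<rho>\<close> the nearest boundary
    point.\<close>
  define D where "D = min 1 ((R - r0) / 2)"
  define \<tau> where "\<tau> = \<sigma> / \<rho>"
  define e where "e = - (real N - 1) / 2"
  have \<rho>: "0 < \<rho>" and \<sigma>: "\<sigma> * \<sigma> = 1" using side r by auto
  have D_bounds: "0 < D" "D \<le> 1" "D \<le> (R - r0) / 2" using r unfolding D_def by (auto simp: min_def)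
  have dist: "bdist r0 R (\<rho> + \<sigma> * s) = s" if "0 < s" "s < D" for s
    using side
  proof
    assume "\<rho> = R \<and> \<sigma> = -1"
    moreover have "bdist r0 R (R - s) = min (R - s - r0) (R - (R - s))"
      by (rule bdist_eq_min) (use that D_bounds r in \<open>simp_all add: field_simps\<close>)
    moreover have "s \<le> R - s - r0" using that D_bounds by (simp add: field_simps)
    ultimately show ?thesis by (simp add: min_def)
  next
    assume "\<rho> = r0 \<and> \<sigma> = 1"
    moreover have "bdist r0 R (r0 + s) = min (r0 + s - r0) (R - (r0 + s))"
      by (rule bdist_eq_min) (use that D_bounds r in \<open>simp_all add: field_simps\<close>)
    moreover have "s \<le> R - (r0 + s)" using that D_bounds by (simp add: field_simps)
    ultimately show ?thesis by (simp add: min_def)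
  qed
  interpret singular_ode \<beta> p \<tau> e D
  proof
    show "\<beta> < 0" using beta by (simp add: \<beta>_def)
    fix x assume x: "x \<in> {0..D}"
    have "0 < \<rho> + \<sigma> * x" using side r x D_bounds by (auto simp: field_simps)
    then show "0 < 1 + \<tau> * x" using \<rho> by (simp add: \<tau>_def field_simps)
  qed (use p D_bounds in auto)
  have \<mu>: "\<beta> - \<beta>\<^sup>2 = \<mu>" unfolding \<beta>_def by (rule beta_minus_eq[OF beta])
  have beta_plus: "beta_plus \<mu> = 1 - \<beta>" unfolding \<beta>_def by (rule beta_plus_eq)
  have slope: "e * \<tau> = - \<sigma> * (real N - 1) / (2 * \<rho>)"
  proof -
    have "- n / 2 * (\<sigma> / \<rho>) = - \<sigma> * n / (2 * \<rho>)" for n by simp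
    then show ?thesis unfolding e_def \<tau>_def .
  qed
  have drift: "drift s = \<sigma> * (real N - 1) / (\<rho> + \<sigma> * s)" for s
  proof -
    have "- 2 * e * \<tau> = \<sigma> * (real N - 1) / \<rho>" using slope by simp
    moreover have "1 + \<tau> * s = (\<rho> + \<sigma> * s) / \<rho>"
      using \<rho> by (simp add: \<tau>_def add_divide_distrib)
    ultimately have "drift s = \<sigma> * (real N - 1) / \<rho> / ((\<rho> + \<sigma> * s) / \<rho>)"
      by (simp only: drift_def)
    then show ?thesis using \<rho> by (simp only: divide_divide_eq_left) simp
  qed
  have "\<forall>v. 0 < v \<longrightarrow> (\<exists>d. 0 < d \<and> d \<le> D \<and> (\<forall>c. \<exists>z B. profile v d c z B))"
  proof (intro allI impI)
    fix v :: real assume "0 < v"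
    from profile_exists[OF this]
    show "\<exists>d. 0 < d \<and> d \<le> D \<and> (\<forall>c. \<exists>z B. profile v d c z B)" by blast
  qed
  then obtain dd zz BB where dd: "\<And>v. 0 < v \<Longrightarrow> 0 < dd v" "\<And>v. 0 < v \<Longrightarrow> dd v \<le> D"
    and zz: "\<And>v c. 0 < v \<Longrightarrow> profile v (dd v) c (zz v c) (BB v c)"
    by metis
  \<comment> \<open>The factor \<open>1 - 2*\<beta>\<close> makes \<open>C\<close> the coefficient
    of \<open>s powr (1 - \<beta>)\<close>, as the flux differentiates
    \<open>s powr (1 - 2*\<beta>)\<close>.\<close>
  define z where "z v C = zz v ((1 - 2*\<beta>) * C)" for v C
  have P: "profile v (dd v) ((1 - 2*\<beta>) * C) (z v C) (BB v ((1 - 2*\<beta>) * C))" if "0 < v" for v C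
    unfolding z_def using zz that by blast
  define u where "u v C r = sol (z v C) (\<sigma> * (r - \<rho>))" for v C r
  define \<eta> where "\<eta> v C = remainder v C (z v C)" for v C
  have u: "u v C (\<rho> + \<sigma> * s) = sol (z v C) s" for v C s
    using \<sigma> by (simp add: u_def mult.assoc[symmetric])
  have exp: "sol (z v C) s = s powr \<beta> * v * (1 + e * \<tau> * s + \<eta> v C s) + C * s powr (1 - \<beta>)"
    if "0 < v" "0 < s" for v C s
    unfolding \<eta>_def using that by (rule sol_expansion)
  have inter: "\<forall>\<^sub>F s::real in at_right 0. 0 < s"
    by (simp add: eventually_at_right_less)
  \<comment> \<open>Equal remainders would cancel in the difference of the two expansions, leaving
    exactly a positive multiple of \<open>s powr (1 - \<beta>)\<close>.\<close>
  have C_ne: "\<not> (\<forall>\<^sub>F s in at_right 0. \<eta> v C s = \<eta> v C' s)" if v: "0 < v" and C: "C' < C" for v C C'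
  proof
    assume "\<forall>\<^sub>F s in at_right 0. \<eta> v C s = \<eta> v C' s"
    then have "\<forall>\<^sub>F s in at_right 0. sol (z v C) s - sol (z v C') s = (C - C') * s powr (1 - \<beta>)"
      using inter
    proof eventually_elim
      case (elim s)
      then show ?case unfolding exp[OF v elim(2)] by (simp add: algebra_simps)
    qed
    moreover have "0 < C - C'" using C by simp
    ultimately show False
      using sol_diff_not_power[OF v dd(1,2)[OF v] P[OF v] P[OF v]] by blast
  qed
  have v_ne: "\<not> (\<forall>\<^sub>F s in at_right 0. \<eta> 1 C s = \<eta> 2 C s)" for C
  proof
    assume "\<forall>\<^sub>F s in at_right 0. \<eta> 1 C s = \<eta> 2 C s"
    then have "\<forall>\<^sub>F s in at_right 0. 2 * sol (z 1 C) s - sol (z 2 C) s = C * s powr (1 - \<beta>)"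
      using inter
    proof eventually_elim
      case (elim s)
      then show ?case
        unfolding exp[OF zero_less_one elim(2)] exp[OF zero_less_numeral elim(2)]
        by (simp add: algebra_simps)
    qed
    then show False
      using sol_scaled_diff_not_power[OF dd(1,2)[of 1] dd(1,2)[of 2] P[of 1] P[of 2]] by simp
  qed
  have "local_solution_family N p \<mu> r0 R (\<lambda>s. \<rho> + \<sigma> * s) (e * \<tau>) eta_const u \<eta>"
    unfolding local_solution_family_def \<beta>_def[symmetric] beta_plus u
  proof (intro conjI allI impI)
    fix v C :: real assume v: "0 < v"
    obtain d w' w'' where d: "0 < d" "d \<le> dd v"
      and S: "boundary_solution drift (\<beta> - \<beta>\<^sup>2) p d (sol (z v C)) w' w''"
      using sol_boundary_solution[OF v dd(1,2)[OF v] P[OF v]] by blast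
    have "radial_solution_on N p \<mu> r0 R ((\<lambda>s. \<rho> + \<sigma> * s) ` {0<..<d}) (u v C)"
      unfolding u_def[abs_def]
    proof (rule boundary_solution_imp_radial_solution[OF _ \<sigma>])
      show "boundary_solution (\<lambda>s. \<sigma> * (real N - 1) / (\<rho> + \<sigma> * s)) \<mu> p d (sol (z v C)) w' w''"
        using S unfolding \<mu> drift[abs_def] .
      fix s assume "s \<in> {0<..<d}"
      then have "0 < s" "s < D" using d dd(2)[OF v] by auto
      then show "bdist r0 R (\<rho> + \<sigma> * s) = s" by (rule dist)
    qed
    moreover have "d \<le> (R - r0) / 2" using d(2) dd(2)[OF v] D_bounds(3) by (meson order_trans)
    ultimately show "\<exists>\<delta>0>0. \<delta>0 \<le> (R - r0) / 2 \<and>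
        radial_solution_on N p \<mu> r0 R ((\<lambda>s. \<rho> + \<sigma> * s) ` {0<..<\<delta>0}) (u v C) \<and>
        (\<forall>s\<in>{0<..<\<delta>0}. sol (z v C) s =
          s powr \<beta> * v * (1 + e * \<tau> * s + \<eta> v C s) + C * s powr (1 - \<beta>))"
      using d(1) exp[OF v] by (intro exI[of _ d] conjI ballI) (assumption | simp)+
    show "eta_asymptotics \<beta> eta_const (\<eta> v C)"
      unfolding \<eta>_def by (rule remainder_asymptotics[OF v dd(1,2)[OF v] P[OF v]])
  next
    fix v C C' :: real assume v: "0 < v" and C: "C \<noteq> C'"
    show "\<not> (\<forall>\<^sub>F s in at_right 0. sol (z v C) s = sol (z v C') s)"
    proof
      assume "\<forall>\<^sub>F s in at_right 0. sol (z v C) s = sol (z v C') s"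
      \<comment> \<open>The factors \<open>M s\<close> and \<open>s powr \<beta>\<close> are
        positive and can be divided out.\<close>
      then have "\<forall>\<^sub>F s in at_right 0. z v C s = z v C' s"
        using eventually_at_right_real[OF D(1)]
      proof eventually_elim
        case (elim s)
        then show ?case using M_pos[of s] by (simp add: sol_def)
      qed
      then have "(1 - 2*\<beta>) * C = (1 - 2*\<beta>) * C'"
        using profile_parameter_unique[OF v dd(1,2)[OF v] P[OF v] P[OF v]] by blast
      with C beta_neg show False by simp
    qed
  next
    fix v :: real assume v: "0 < v"
    show "\<exists>C>0. \<exists>C'>0. \<not> (\<forall>\<^sub>F s in at_right 0. \<eta> v C s = \<eta> v C' s)"
      using C_ne[OF v, of 1 2] by (intro exI[of _ 2] conjI exI[of _ 1]) auto
  next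
    fix C :: real
    show "\<exists>v>0. \<exists>v'>0. \<not> (\<forall>\<^sub>F s in at_right 0. \<eta> v C s = \<eta> v' C s)"
      using v_ne[of C] by (intro exI[of _ 1] conjI exI[of _ 2]) auto
  qed
  then show ?thesis unfolding slope by blast
qed

theorem lemma2p7:
  fixes N :: nat and p \<mu> r0 R :: real
  assumes "N \<ge> 1" and "0 < p" and "p < 1"
    and "0 < r0" and "r0 < R"
    and "beta_minus \<mu> < 0"
  shows "(\<exists>K u \<eta>. local_solution_family N p \<mu> r0 R
            (\<lambda>\<delta>. R - \<delta>) ((real N - 1) / (2 * R)) K u \<eta>) \<and>
         (\<exists>K u \<eta>. local_solution_family N p \<mu> r0 R
            (\<lambda>\<delta>. r0 + \<delta>) (- (real N - 1) / (2 * r0)) K u \<eta>)"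
proof
  have "(\<lambda>s. R + - 1 * s) = (\<lambda>\<delta>. R - \<delta>)" "- (- 1) * (real N - 1) = real N - 1" by auto
  with local_solution_family_exists[OF assms(2-6) disjI1[OF conjI[OF refl refl]], of N]
  show "\<exists>K u \<eta>. local_solution_family N p \<mu> r0 R (\<lambda>\<delta>. R - \<delta>) ((real N - 1) / (2 * R)) K u \<eta>"
    by (simp only:)
  have "(\<lambda>s. r0 + 1 * s) = (\<lambda>\<delta>. r0 + \<delta>)" "- 1 * (real N - 1) = - (real N - 1)" by auto
  with local_solution_family_exists[OF assms(2-6) disjI2[OF conjI[OF refl refl]], of N]
  show "\<exists>K u \<eta>. local_solution_family N p \<mu> r0 R (\<lambda>\<delta>. r0 + \<delta>) (- (real N - 1) / (2 * r0)) K u \<eta>"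
    by (simp only:)
qed

end
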